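(* Let $T$ be a contraction in a Hilbert space $H$. Define the Hilbert spaces $$\mathfrak H_0=(\mathfrak D_T\oplus\mathfrak D_{T^*})\oplus(\mathfrak D_T\oplus\mathfrak D_{T^*})\oplus\cdots,\qquad \widetilde{\mathfrak H}_0=(\mathfrak D_{T^*}\oplus\mathfrak D_T)\oplus(\mathfrak D_{T^*}\oplus\mathfrak D_T)\oplus\cdots,$$ and $\mathcal H_0=H\oplus\mathfrak H_0$, $\widetilde{\mathcal H}_0=H\oplus\widetilde{\mathfrak H}_0$. Let $$\mathbf J_0=\begin{bmatrix}0&I_{\mathfrak D_{T^*}}\\ I_{\mathfrak D_T}&0\end{bmatrix}:\mathfrak D_T\oplus\mathfrak D_{T^*}\to\mathfrak D_{T^*}\oplus\mathfrak D_T,\qquad \mathbf J_T=\begin{bmatrix}T&D_{T^*}\\ D_T&-T^*\end{bmatrix}:H\oplus\mathfrak D_{T^*}\to H\oplus\mathfrak D_T,$$ and define the operators $$\mathcal M_0=I_H\oplus\mathbf J_0\oplus\mathbf J_0\oplus\cdots:\mathcal H_0\to\widetilde{\mathcal H}_0,\qquad \mathcal L_0=\mathbf J_T\oplus\mathbf J_0\oplus\mathbf J_0\oplus\cdots:\widetilde{\mathcal H}_0\to\mathcal H_0,$$ $$\mathcal U_0=\mathcal L_0\mathcal M_0:\mathcal H_0\to\mathcal H_0,\qquad \widetilde{\mathcal U}_0=\mathcal M_0\mathcal L_0:\widetilde{\mathcal H}_0\to\widetilde{\mathcal H}_0 .$$ Then $\{\mathcal H_0,\mathcal U_0\}$ and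 $\{\widetilde{\mathcal H}_0,\widetilde{\mathcal U}_0\}$ are unitarily equivalent minimal unitary dilations of the operator $T$.
   Context: For a contraction $T$: $D_T=(I-T^*T)^{1/2}$, $D_{T^*}=(I-TT^* )^{1/2}$, $\mathfrak D_T=\overline{\mathrm{ran}}\,D_T$, $\mathfrak D_{T^*}=\overline{\mathrm{ran}}\,D_{T^*}$ (either may be $\{0\}$). Infinite sums are Hilbert space orthogonal sums. In $\mathcal L_0$ the spaces are regrouped as $\widetilde{\mathcal H}_0=(H\oplus\mathfrak D_{T^*})\oplus(\mathfrak D_T\oplus\mathfrak D_{T^*})\oplus(\mathfrak D_T\oplus\mathfrak D_{T^*})\oplus\cdots$ and $\mathcal H_0=(H\oplus\mathfrak D_T)\oplus(\mathfrak D_{T^*}\oplus\mathfrak D_T)\oplus(\mathfrak D_{T^*}\oplus\mathfrak D_T)\oplus\cdots$. A unitary operator $U$ in a Hilbert space $\mathcal H\supset H$ is a unitary dilation of $T$ if $T^n=P_HU^n\!\upharpoonright H$ for all $n\in\mathbb N$, where $P_H$ is the orthogonal projection onto $H$; it is minimal if $\overline{\mathrm{span}}\{U^nH:\ n\in\mathbb Z\}=\mathcal H$. *)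

theory Defs
  imports "HOL-Analysis.Analysis"
begin

section \<open>Complex Hilbert spaces\<close>

text \<open>
  The inner product is linear in its first argument. The norm and the topology are those of the
  underlying real inner product \<open>Re (cinner x y)\<close>, so \<open>norm x = sqrt (Re (cinner x x))\<close>.
\<close>

class complex_inner = real_inner +
  fixes scaleC :: "complex \<Rightarrow> 'a \<Rightarrow> 'a" (infixr \<open>*\<^sub>C\<close> 75)
    and cinner :: "'a \<Rightarrow> 'a \<Rightarrow> complex"
  assumes scaleC_add_right: "c *\<^sub>C (x + y) = c *\<^sub>C x + c *\<^sub>C y"
    and scaleC_add_left: "(c + d) *\<^sub>C x = c *\<^sub>C x + d *\<^sub>C x"
    and scaleC_scaleC: "c *\<^sub>C d *\<^sub>C x = (c * d) *\<^sub>C x"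
    and scaleC_of_real: "complex_of_real r *\<^sub>C x = r *\<^sub>R x"
    and cinner_add_left: "cinner (x + y) z = cinner x z + cinner y z"
    and cinner_scaleC_left: "cinner (c *\<^sub>C x) y = c * cinner x y"
    and cinner_commute: "cinner x y = cnj (cinner y x)"
    and inner_eq_Re_cinner: "inner x y = Re (cinner x y)"

class chilbert_space = complex_inner + complete_space

global_interpretation complex_vector: vector_space "scaleC :: complex \<Rightarrow> 'a \<Rightarrow> 'a :: complex_inner"
proof
  fix x :: 'a
  show "1 *\<^sub>C x = x" using scaleC_of_real[of 1 x] by simp
qed (rule scaleC_add_right scaleC_add_left scaleC_scaleC)+

abbreviation csubspace :: "'a::complex_inner set \<Rightarrow> bool"
  where "csubspace \<equiv> module.subspace scaleC"

abbreviation cspan :: "'a::complex_inner set \<Rightarrow> 'a set"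
  where "cspan \<equiv> module.span scaleC"

abbreviation clinear :: "('a::complex_inner \<Rightarrow> 'b::complex_inner) \<Rightarrow> bool"
  where "clinear \<equiv> Vector_Spaces.linear scaleC scaleC"

lemma norm_scaleC: "norm (c *\<^sub>C x) = norm c * norm x" for x :: "'a::complex_inner"
proof -
  have "cinner (c *\<^sub>C x) (c *\<^sub>C x) = c * cinner x (c *\<^sub>C x)"
    by (rule cinner_scaleC_left)
  also have "cinner x (c *\<^sub>C x) = cnj c * cinner x x"
    by (metis cinner_commute cinner_scaleC_left complex_cnj_mult)
  finally have "cinner (c *\<^sub>C x) (c *\<^sub>C x) = complex_of_real ((norm c)\<^sup>2) * cinner x x"
    by (simp only: complex_norm_square mult.assoc)
  then show ?thesis
    by (simp add: norm_eq_sqrt_inner inner_eq_Re_cinner real_sqrt_mult)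
qed

lemma norm_cinner_le: "norm (cinner x y) \<le> 2 * (norm x * norm y)"
  for x y :: "'a::complex_inner"
proof -
  have re: "\<bar>Re (cinner u y)\<bar> \<le> norm u * norm y" for u :: 'a
    using Cauchy_Schwarz_ineq2[of u y] by (simp add: inner_eq_Re_cinner)
  have "norm (- \<i> *\<^sub>C x) = norm x"
    by (simp add: norm_scaleC del: complex_vector.scale_minus_left)
  moreover have "Re (cinner (- \<i> *\<^sub>C x) y) = Im (cinner x y)"
    by (simp add: cinner_scaleC_left del: complex_vector.scale_minus_left)
  ultimately have "\<bar>Im (cinner x y)\<bar> \<le> norm x * norm y"
    using re[of "- \<i> *\<^sub>C x"] by simp
  then show ?thesis
    using re[of x] cmod_le[of "cinner x y"] by linarith
qed

section \<open>The Hilbert space of square-summable sequences\<close>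

typedef (overloaded) ('a::complex_inner) ell2 = "{f :: nat \<Rightarrow> 'a. summable (\<lambda>n. (norm (f n))\<^sup>2)}"
  morphisms ell2_nth Abs_ell2
  by (rule exI[of _ "\<lambda>_. 0"]) simp

setup_lifting type_definition_ell2

lemma sq_norm_add_le: "(norm (x + y))\<^sup>2 \<le> 2 * (norm x)\<^sup>2 + 2 * (norm y)\<^sup>2"
  for x y :: "'a::real_normed_vector"
proof -
  have "(norm (x + y))\<^sup>2 \<le> (norm x + norm y)\<^sup>2"
    by (simp add: norm_triangle_ineq power_mono)
  also have "\<dots> \<le> 2 * (norm x)\<^sup>2 + 2 * (norm y)\<^sup>2"
    using sum_squares_bound[of "norm x" "norm y"] by (simp add: power2_sum)
  finally show ?thesis .
qed

lemma summable_sq_norm_add: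
  fixes f g :: "nat \<Rightarrow> 'a::real_normed_vector"
  assumes "summable (\<lambda>n. (norm (f n))\<^sup>2)" "summable (\<lambda>n. (norm (g n))\<^sup>2)"
  shows "summable (\<lambda>n. (norm (f n + g n))\<^sup>2)"
  by (rule summable_comparison_test'[where g = "\<lambda>n. 2 * (norm (f n))\<^sup>2 + 2 * (norm (g n))\<^sup>2" and N = 0])
    (auto intro!: summable_add summable_mult assms sq_norm_add_le)

lemma summable_sq_norm_scaleC:
  fixes f :: "nat \<Rightarrow> 'a::complex_inner"
  shows "summable (\<lambda>n. (norm (f n))\<^sup>2) \<Longrightarrow> summable (\<lambda>n. (norm (c *\<^sub>C f n))\<^sup>2)"
  by (simp add: norm_scaleC power_mult_distrib summable_mult)

lemma summable_cinner:
  fixes f g :: "nat \<Rightarrow> 'a::complex_inner"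
  assumes "summable (\<lambda>n. (norm (f n))\<^sup>2)" "summable (\<lambda>n. (norm (g n))\<^sup>2)"
  shows "summable (\<lambda>n. cinner (f n) (g n))"
proof (rule summable_comparison_test'[where g = "\<lambda>n. (norm (f n))\<^sup>2 + (norm (g n))\<^sup>2" and N = 0])
  fix n
  show "norm (cinner (f n) (g n)) \<le> (norm (f n))\<^sup>2 + (norm (g n))\<^sup>2"
    using norm_cinner_le[of "f n" "g n"] sum_squares_bound[of "norm (f n)" "norm (g n)"] by simp
qed (intro summable_add assms)

instantiation ell2 :: (complex_inner) complex_inner
begin

lift_definition zero_ell2 :: "'a ell2" is "\<lambda>_. 0" by simp

lift_definition plus_ell2 :: "'a ell2 \<Rightarrow> 'a ell2 \<Rightarrow> 'a ell2" is "\<lambda>f g n. f n + g n"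
  by (rule summable_sq_norm_add)

lift_definition uminus_ell2 :: "'a ell2 \<Rightarrow> 'a ell2" is "\<lambda>f n. - f n" by simp

lift_definition minus_ell2 :: "'a ell2 \<Rightarrow> 'a ell2 \<Rightarrow> 'a ell2" is "\<lambda>f g n. f n - g n"
  using summable_sq_norm_add[where g = "\<lambda>n. - g n" for g] by simp

lift_definition scaleR_ell2 :: "real \<Rightarrow> 'a ell2 \<Rightarrow> 'a ell2" is "\<lambda>r f n. r *\<^sub>R f n"
  using summable_sq_norm_scaleC[of _ "complex_of_real r" for r] by (simp add: scaleC_of_real)

lift_definition scaleC_ell2 :: "complex \<Rightarrow> 'a ell2 \<Rightarrow> 'a ell2" is "\<lambda>c f n. c *\<^sub>C f n"
  by (rule summable_sq_norm_scaleC)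

lift_definition cinner_ell2 :: "'a ell2 \<Rightarrow> 'a ell2 \<Rightarrow> complex"
  is "\<lambda>f g. \<Sum>n. cinner (f n) (g n)" .

definition inner_ell2 :: "'a ell2 \<Rightarrow> 'a ell2 \<Rightarrow> real"
  where "inner_ell2 f g = Re (cinner f g)"

definition norm_ell2 :: "'a ell2 \<Rightarrow> real"
  where "norm_ell2 f = sqrt (inner f f)"

definition sgn_ell2 :: "'a ell2 \<Rightarrow> 'a ell2"
  where "sgn_ell2 f = scaleR (inverse (norm f)) f"

definition dist_ell2 :: "'a ell2 \<Rightarrow> 'a ell2 \<Rightarrow> real"
  where "dist_ell2 f g = norm (f - g)"

definition uniformity_ell2 :: "('a ell2 \<times> 'a ell2) filter"
  where "uniformity_ell2 = (INF e\<in>{0 <..}. principal {(x, y). dist x y < e})"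

definition open_ell2 :: "'a ell2 set \<Rightarrow> bool"
  where "open_ell2 S = (\<forall>x\<in>S. \<forall>\<^sub>F (x', y) in uniformity. x' = x \<longrightarrow> y \<in> S)"

lemma cinner_self_eq: "cinner x x = complex_of_real ((norm x)\<^sup>2)" for x :: "'b::complex_inner"
proof -
  have "Im (cinner x x) = 0"
    using arg_cong[OF cinner_commute[of x x], of Im] by simp
  then show ?thesis
    by (simp add: complex_eq_iff power2_norm_eq_inner inner_eq_Re_cinner)
qed

lemma cinner_ell2_self: "cinner f f = complex_of_real (\<Sum>n. (norm (ell2_nth f n))\<^sup>2)"
  for f :: "'a ell2"
  unfolding cinner_ell2.rep_eq cinner_self_eq
  using ell2_nth[of f] by (intro suminf_of_real[symmetric]) simp

instance
proof
  fix f g h :: "'a ell2" and r s :: real and c d :: complex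
  show "f + g + h = f + (g + h)" "f + g = g + f" "0 + f = f" "- f + f = 0" "f - g = f + - g"
    by (transfer; simp add: fun_eq_iff add_ac)+
  show "r *\<^sub>R (f + g) = r *\<^sub>R f + r *\<^sub>R g" "(r + s) *\<^sub>R f = r *\<^sub>R f + s *\<^sub>R f"
    "r *\<^sub>R s *\<^sub>R f = (r * s) *\<^sub>R f" "1 *\<^sub>R f = f"
    by (transfer; simp add: scaleR_add_right scaleR_add_left)+
  show "c *\<^sub>C (f + g) = c *\<^sub>C f + c *\<^sub>C g" "(c + d) *\<^sub>C f = c *\<^sub>C f + d *\<^sub>C f"
    "c *\<^sub>C d *\<^sub>C f = (c * d) *\<^sub>C f" "complex_of_real r *\<^sub>C f = r *\<^sub>R f"
    by (transfer; simp add: scaleC_add_right scaleC_add_left scaleC_of_real)+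
  show cadd: "cinner (f + g) h = cinner f h + cinner g h"
    by transfer (simp add: cinner_add_left suminf_add summable_cinner)
  show cscale: "cinner (c *\<^sub>C f) g = c * cinner f g" for c
    by transfer (simp add: cinner_scaleC_left suminf_mult summable_cinner)
  show ccomm: "cinner f g = cnj (cinner g f)"
  proof transfer
    fix f g :: "nat \<Rightarrow> 'a"
    assume "summable (\<lambda>n. (norm (f n))\<^sup>2)" "summable (\<lambda>n. (norm (g n))\<^sup>2)"
    then have "(\<lambda>n. cinner (g n) (f n)) sums (\<Sum>n. cinner (g n) (f n))"
      by (intro summable_sums summable_cinner)
    then have "(\<lambda>n. cnj (cinner (g n) (f n))) sums cnj (\<Sum>n. cinner (g n) (f n))"
      by (simp only: sums_cnj)
    then show "(\<Sum>n. cinner (f n) (g n)) = cnj (\<Sum>n. cinner (g n) (f n))"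
      by (subst cinner_commute) (rule sums_unique[symmetric])
  qed
  show "inner f g = inner g f"
    by (simp add: inner_ell2_def) (subst ccomm, simp)
  show "inner (f + g) h = inner f h + inner g h"
    by (simp add: inner_ell2_def cadd)
  have "r *\<^sub>R f = complex_of_real r *\<^sub>C f"
    by (transfer; simp add: scaleC_of_real)
  then show "inner (r *\<^sub>R f) g = r * inner f g"
    by (simp add: inner_ell2_def cscale)
  have summ: "summable (\<lambda>n. (norm (ell2_nth f n))\<^sup>2)"
    using ell2_nth[of f] by simp
  show "0 \<le> inner f f"
    using summ by (simp add: inner_ell2_def cinner_ell2_self suminf_nonneg)
  show "inner f f = 0 \<longleftrightarrow> f = 0"
  proof -
    have "inner f f = 0 \<longleftrightarrow> (\<forall>n. ell2_nth f n = 0)"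
      using summ by (simp add: inner_ell2_def cinner_ell2_self suminf_eq_zero_iff)
    also have "\<dots> \<longleftrightarrow> f = 0"
      by (simp add: ell2_nth_inject[symmetric] zero_ell2.rep_eq fun_eq_iff)
    finally show ?thesis .
  qed
qed (fact inner_ell2_def norm_ell2_def sgn_ell2_def dist_ell2_def uniformity_ell2_def open_ell2_def)+

end

lemma norm_ell2_power2: "(norm f)\<^sup>2 = (\<Sum>n. (norm (ell2_nth f n))\<^sup>2)"
  by (simp add: power2_norm_eq_inner inner_eq_Re_cinner cinner_ell2_self)

lemma summable_ell2_nth: "summable (\<lambda>n. (norm (ell2_nth f n))\<^sup>2)"
  using ell2_nth[of f] by simp

lemma sum_norm_ell2_nth_le: "(\<Sum>i<k. (norm (ell2_nth f i))\<^sup>2) \<le> (norm f)\<^sup>2"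
  unfolding norm_ell2_power2 by (rule sum_le_suminf[OF summable_ell2_nth]) auto

lemma norm_ell2_nth_le: "norm (ell2_nth f i) \<le> norm f"
proof -
  have "(norm (ell2_nth f i))\<^sup>2 \<le> (\<Sum>j<Suc i. (norm (ell2_nth f j))\<^sup>2)"
    by (simp add: sum_nonneg)
  also note sum_norm_ell2_nth_le
  finally show ?thesis by (rule power2_le_imp_le) simp
qed

instance ell2 :: (chilbert_space) chilbert_space
proof
  fix X :: "nat \<Rightarrow> 'a ell2"
  assume X: "Cauchy X"
  have "Cauchy (\<lambda>m. ell2_nth (X m) i)" for i
  proof (rule metric_CauchyI)
    fix e :: real assume "0 < e"
    then obtain N where "\<And>m n. m \<ge> N \<Longrightarrow> n \<ge> N \<Longrightarrow> dist (X m) (X n) < e"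
      using metric_CauchyD[OF X] by blast
    then show "\<exists>N. \<forall>m\<ge>N. \<forall>n\<ge>N. dist (ell2_nth (X m) i) (ell2_nth (X n) i) < e"
      by (metis dist_norm le_less_trans minus_ell2.rep_eq norm_ell2_nth_le)
  qed
  then have "\<exists>l. (\<lambda>m. ell2_nth (X m) i) \<longlonglongrightarrow> l" for i
    using Cauchy_convergent convergent_def by blast
  then obtain L where L: "(\<lambda>m. ell2_nth (X m) i) \<longlonglongrightarrow> L i" for i
    by metis
  have tail: "\<exists>N. \<forall>m\<ge>N. \<forall>k. (\<Sum>i<k. (norm (ell2_nth (X m) i - L i))\<^sup>2) \<le> e\<^sup>2"
    if "0 < e" for e :: real
  proof -
    obtain N where N: "\<And>m n. m \<ge> N \<Longrightarrow> n \<ge> N \<Longrightarrow> dist (X m) (X n) < e"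
      using metric_CauchyD[OF X \<open>0 < e\<close>] by blast
    have "(\<Sum>i<k. (norm (ell2_nth (X m) i - L i))\<^sup>2) \<le> e\<^sup>2" if "m \<ge> N" for m k
    proof (rule LIMSEQ_le_const2)
      show "(\<lambda>n. \<Sum>i<k. (norm (ell2_nth (X m) i - ell2_nth (X n) i))\<^sup>2)
          \<longlonglongrightarrow> (\<Sum>i<k. (norm (ell2_nth (X m) i - L i))\<^sup>2)"
        by (intro tendsto_intros L)
      have "(\<Sum>i<k. (norm (ell2_nth (X m) i - ell2_nth (X n) i))\<^sup>2) \<le> e\<^sup>2" if "n \<ge> N" for n
      proof -
        have "(\<Sum>i<k. (norm (ell2_nth (X m) i - ell2_nth (X n) i))\<^sup>2) \<le> (norm (X m - X n))\<^sup>2"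
          using sum_norm_ell2_nth_le[of "X m - X n" k] by (simp add: minus_ell2.rep_eq)
        also have "\<dots> \<le> e\<^sup>2"
          using N[OF \<open>m \<ge> N\<close> \<open>n \<ge> N\<close>] by (simp add: dist_norm power_mono)
        finally show ?thesis .
      qed
      then show "\<exists>N. \<forall>n\<ge>N. (\<Sum>i<k. (norm (ell2_nth (X m) i - ell2_nth (X n) i))\<^sup>2) \<le> e\<^sup>2"
        by blast
    qed
    then show ?thesis by blast
  qed
  have diff: "summable (\<lambda>i. (norm (ell2_nth (X m) i - L i))\<^sup>2)"
    if "\<forall>k. (\<Sum>i<k. (norm (ell2_nth (X m) i - L i))\<^sup>2) \<le> e\<^sup>2" for m and e :: real
    using that by (intro bounded_imp_summable[where B = "e\<^sup>2"])
      (auto simp: lessThan_Suc_atMost[symmetric] simp del: sum.lessThan_Suc)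
  obtain M where M: "\<forall>k. (\<Sum>i<k. (norm (ell2_nth (X M) i - L i))\<^sup>2) \<le> 1\<^sup>2"
    using tail[of 1] by auto
  have "summable (\<lambda>i. (norm (ell2_nth (X M) i + (- (ell2_nth (X M) i - L i))))\<^sup>2)"
    using diff[OF M] by (intro summable_sq_norm_add summable_ell2_nth) (simp only: norm_minus_cancel)
  then have "summable (\<lambda>i. (norm (L i))\<^sup>2)"
    by simp
  then have nth: "ell2_nth (Abs_ell2 L) = L"
    by (simp add: Abs_ell2_inverse)
  have "X \<longlonglongrightarrow> Abs_ell2 L"
  proof (rule metric_LIMSEQ_I)
    fix r :: real assume "0 < r"
    then obtain N where N: "\<And>m. m \<ge> N \<Longrightarrow> \<forall>k. (\<Sum>i<k. (norm (ell2_nth (X m) i - L i))\<^sup>2) \<le> (r / 2)\<^sup>2"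
      using tail[of "r / 2"] by auto
    have "dist (X m) (Abs_ell2 L) < r" if "m \<ge> N" for m
    proof -
      have "(norm (X m - Abs_ell2 L))\<^sup>2 = (\<Sum>i. (norm (ell2_nth (X m) i - L i))\<^sup>2)"
        by (simp add: norm_ell2_power2 minus_ell2.rep_eq nth)
      also have "\<dots> \<le> (r / 2)\<^sup>2"
        using N[OF that] diff[OF N[OF that]] by (intro suminf_le_const) auto
      finally have "norm (X m - Abs_ell2 L) \<le> r / 2"
        by (rule power2_le_imp_le) (use \<open>0 < r\<close> in simp)
      then show ?thesis
        using \<open>0 < r\<close> by (simp add: dist_norm)
    qed
    then show "\<exists>N. \<forall>m\<ge>N. dist (X m) (Abs_ell2 L) < r" by blast
  qed
  then show "convergent X" by (auto simp: convergent_def)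
qed

section \<open>Operators on Hilbert spaces\<close>

definition contraction :: "('a::complex_inner \<Rightarrow> 'b::complex_inner) \<Rightarrow> bool"
  where "contraction T \<longleftrightarrow> clinear T \<and> (\<forall>x. norm (T x) \<le> norm x)"

definition bounded_clinear :: "('a::complex_inner \<Rightarrow> 'b::complex_inner) \<Rightarrow> bool"
  where "bounded_clinear T \<longleftrightarrow> clinear T \<and> (\<exists>K. \<forall>x. norm (T x) \<le> K * norm x)"

definition cadjoint :: "('a::complex_inner \<Rightarrow> 'b::complex_inner) \<Rightarrow> 'b \<Rightarrow> 'a"
  where "cadjoint T = (THE S. \<forall>x y. cinner (T x) y = cinner x (S y))"

text \<open>The unique positive square root of a positive bounded operator.\<close>

definition op_sqrt :: "('a::complex_inner \<Rightarrow> 'a) \<Rightarrow> 'a \<Rightarrow> 'a"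
  where "op_sqrt A =
    (THE B. bounded_clinear B \<and> (\<forall>x. cinner (B x) x \<in> \<real>\<^sub>\<ge>\<^sub>0) \<and> B \<circ> B = A)"

text \<open>\<open>D\<^sub>T = (I - T\<^sup>* T)\<^sup>1\<^sup>/\<^sup>2\<close> and \<open>D\<^sub>T\<^sub>* = (I - T T\<^sup>*)\<^sup>1\<^sup>/\<^sup>2\<close>.\<close>

definition defect_op :: "('a::complex_inner \<Rightarrow> 'a) \<Rightarrow> 'a \<Rightarrow> 'a"
  where "defect_op T = op_sqrt (\<lambda>x. x - cadjoint T (T x))"

definition defect_op_adj :: "('a::complex_inner \<Rightarrow> 'a) \<Rightarrow> 'a \<Rightarrow> 'a"
  where "defect_op_adj T = op_sqrt (\<lambda>x. x - T (cadjoint T x))"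

definition defect_space :: "('a::complex_inner \<Rightarrow> 'a) \<Rightarrow> 'a set"
  where "defect_space T = closure (range (defect_op T))"

definition defect_space_adj :: "('a::complex_inner \<Rightarrow> 'a) \<Rightarrow> 'a set"
  where "defect_space_adj T = closure (range (defect_op_adj T))"

text \<open>
  Hilbert spaces that are not whole types are represented by closed subspaces of some
  \<open>chilbert_space\<close> type; values of operators outside of these subspaces are irrelevant.
\<close>

definition hilbert_subspace :: "'a::chilbert_space set \<Rightarrow> bool"
  where "hilbert_subspace K \<longleftrightarrow> csubspace K \<and> closed K"

definition proj_onto :: "'a::complex_inner set \<Rightarrow> 'a \<Rightarrow> 'a"
  where "proj_onto M x = (THE y. y \<in> M \<and> (\<forall>m\<in>M. cinner (x - y) m = 0))"

definition unitary_between ::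
    "'a::complex_inner set \<Rightarrow> 'b::complex_inner set \<Rightarrow> ('a \<Rightarrow> 'b) \<Rightarrow> bool"
  where "unitary_between K L U \<longleftrightarrow>
    bij_betw U K L \<and>
    (\<forall>x\<in>K. \<forall>y\<in>K. U (x + y) = U x + U y) \<and>
    (\<forall>c. \<forall>x\<in>K. U (c *\<^sub>C x) = c *\<^sub>C U x) \<and>
    (\<forall>x\<in>K. \<forall>y\<in>K. cinner (U x) (U y) = cinner x y)"

definition int_power_on :: "'a set \<Rightarrow> ('a \<Rightarrow> 'a) \<Rightarrow> int \<Rightarrow> 'a \<Rightarrow> 'a"
  where "int_power_on K U n = (if 0 \<le> n then U ^^ nat n else inv_into K U ^^ nat (- n))"

section \<open>Unitary dilations\<close>

text \<open>
  The inclusion of \<open>H\<close> into the larger Hilbert space \<open>K\<close> is given by an isometric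
  embedding \<open>V\<close>; thus \<open>range V\<close> is the copy of \<open>H\<close> in \<open>K\<close>.
\<close>

definition unitary_dilation ::
    "('h::chilbert_space \<Rightarrow> 'h) \<Rightarrow> ('h \<Rightarrow> 'k::chilbert_space) \<Rightarrow> 'k set \<Rightarrow> ('k \<Rightarrow> 'k) \<Rightarrow> bool"
  where "unitary_dilation T V K U \<longleftrightarrow>
    hilbert_subspace K \<and>
    clinear V \<and> (\<forall>x y. cinner (V x) (V y) = cinner x y) \<and> range V \<subseteq> K \<and>
    unitary_between K K U \<and>
    (\<forall>n h. V ((T ^^ n) h) = proj_onto (range V) ((U ^^ n) (V h)))"

definition minimal_unitary_dilation ::
    "('h::chilbert_space \<Rightarrow> 'h) \<Rightarrow> ('h \<Rightarrow> 'k::chilbert_space) \<Rightarrow> 'k set \<Rightarrow> ('k \<Rightarrow> 'k) \<Rightarrow> bool"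
  where "minimal_unitary_dilation T V K U \<longleftrightarrow>
    unitary_dilation T V K U \<and>
    closure (cspan (\<Union>n. int_power_on K U n ` range V)) = K"

text \<open>
  Unitary equivalence of dilations of an operator in \<open>H\<close>: the intertwining unitary operator
  is the identity on \<open>H\<close>.
\<close>

definition unitarily_equivalent_dilations ::
    "('h::chilbert_space \<Rightarrow> 'k::chilbert_space) \<Rightarrow> 'k set \<Rightarrow> ('k \<Rightarrow> 'k) \<Rightarrow>
     ('h \<Rightarrow> 'l::chilbert_space) \<Rightarrow> 'l set \<Rightarrow> ('l \<Rightarrow> 'l) \<Rightarrow> bool"
  where "unitarily_equivalent_dilations V K U V' K' U' \<longleftrightarrow>
    (\<exists>W. unitary_between K K' W \<and> (\<forall>x\<in>K. W (U x) = U' (W x)) \<and> (\<forall>h. W (V h) = V' h))"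

section \<open>The spaces and operators built from the contraction\<close>

text \<open>The orthogonal sum of a sequence of closed subspaces of \<open>'a\<close>.\<close>

definition orth_sum :: "(nat \<Rightarrow> 'a::complex_inner set) \<Rightarrow> 'a ell2 set"
  where "orth_sum S = {f. \<forall>n. ell2_nth f n \<in> S n}"

definition alternating :: "'b \<Rightarrow> 'b \<Rightarrow> nat \<Rightarrow> 'b"
  where "alternating A B n = (if even n then A else B)"

text \<open>
  \<open>H0 T\<close> is \<open>H \<oplus> (\<DD>\<^sub>T \<oplus> \<DD>\<^sub>T\<^sub>*) \<oplus> (\<DD>\<^sub>T \<oplus> \<DD>\<^sub>T\<^sub>*) \<oplus> \<dots>\<close> and \<open>H0_tilde T\<close> is
  \<open>H \<oplus> (\<DD>\<^sub>T\<^sub>* \<oplus> \<DD>\<^sub>T) \<oplus> (\<DD>\<^sub>T\<^sub>* \<oplus> \<DD>\<^sub>T) \<oplus> \<dots>\<close>. Their elements are stored as sequences, not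
  as nested pairs, so that regrouping the summands does not change the element.
\<close>

definition H0 :: "('a::complex_inner \<Rightarrow> 'a) \<Rightarrow> 'a ell2 set"
  where "H0 T = orth_sum (case_nat UNIV (alternating (defect_space T) (defect_space_adj T)))"

definition H0_tilde :: "('a::complex_inner \<Rightarrow> 'a) \<Rightarrow> 'a ell2 set"
  where "H0_tilde T = orth_sum (case_nat UNIV (alternating (defect_space_adj T) (defect_space T)))"

lift_definition embed_H :: "'a::complex_inner \<Rightarrow> 'a ell2" is "\<lambda>h. case_nat h (\<lambda>_. 0)"
  by (rule iffD1[OF summable_Suc_iff]) (simp del: summable_Suc_iff)

definition J0 :: "'a \<times> 'a \<Rightarrow> 'a \<times> 'a"
  where "J0 = (\<lambda>(x, y). (y, x))"

definition JT :: "('a::complex_inner \<Rightarrow> 'a) \<Rightarrow> 'a \<times> 'a \<Rightarrow> 'a \<times> 'a"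
  where "JT T = (\<lambda>(x, y). (T x + defect_op_adj T y, defect_op T x - cadjoint T y))"

text \<open>The direct sum of \<open>J 0, J 1, \<dots>\<close>, where \<open>J k\<close> acts on the entries \<open>2 * k\<close> and \<open>2 * k + 1\<close>.\<close>

definition pair_sum :: "(nat \<Rightarrow> 'a \<times> 'a \<Rightarrow> 'a \<times> 'a) \<Rightarrow> (nat \<Rightarrow> 'a) \<Rightarrow> nat \<Rightarrow> 'a"
  where "pair_sum J f n =
    (let k = n div 2; p = J k (f (2 * k), f (2 * k + 1)) in if even n then fst p else snd p)"

lemma summable_pair_sum_J0:
  fixes f :: "nat \<Rightarrow> 'a::real_normed_vector"
  assumes f: "summable (\<lambda>n. (norm (f n))\<^sup>2)" and J: "\<And>k. k > 0 \<Longrightarrow> J k = J0"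
  shows "summable (\<lambda>n. (norm (pair_sum J f n))\<^sup>2)"
proof (rule summable_comparison_test'[where N = 2])
  show "summable (\<lambda>n. (norm (f (n - 1)))\<^sup>2 + (norm (f (n + 1)))\<^sup>2)"
  proof (rule summable_add)
    show "summable (\<lambda>n. (norm (f (n - 1)))\<^sup>2)"
      by (rule iffD1[OF summable_Suc_iff]) (simp add: f del: summable_Suc_iff)
    show "summable (\<lambda>n. (norm (f (n + 1)))\<^sup>2)"
      unfolding Suc_eq_plus1[symmetric] by (rule iffD2[OF summable_Suc_iff f])
  qed
  fix n :: nat assume "2 \<le> n"
  then have "n div 2 > 0" by simp
  then have "J (n div 2) = J0" by (rule J)
  moreover have "even n \<Longrightarrow> 2 * (n div 2) = n" "odd n \<Longrightarrow> 2 * (n div 2) = n - 1"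
    by (simp, metis odd_two_times_div_two_nat)
  ultimately have "pair_sum J f n = (if even n then f (n + 1) else f (n - 1))"
    by (simp add: pair_sum_def J0_def Let_def)
  then show "norm ((norm (pair_sum J f n))\<^sup>2) \<le> (norm (f (n - 1)))\<^sup>2 + (norm (f (n + 1)))\<^sup>2"
    by simp
qed

lift_definition M0 :: "'a::complex_inner ell2 \<Rightarrow> 'a ell2"
  is "\<lambda>f. case_nat (f 0) (pair_sum (\<lambda>_. J0) (\<lambda>n. f (Suc n)))"
proof -
  fix f :: "nat \<Rightarrow> 'a"
  assume "summable (\<lambda>n. (norm (f n))\<^sup>2)"
  then have f: "summable (\<lambda>n. (norm (f (Suc n)))\<^sup>2)"
    by (rule iffD2[OF summable_Suc_iff])
  show "summable (\<lambda>n. (norm (case_nat (f 0) (pair_sum (\<lambda>_. J0) (\<lambda>n. f (Suc n))) n))\<^sup>2)"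
    by (rule iffD1[OF summable_Suc_iff]) (simp add: summable_pair_sum_J0[OF f] del: summable_Suc_iff)
qed

lift_definition L0 :: "('a::complex_inner \<Rightarrow> 'a) \<Rightarrow> 'a ell2 \<Rightarrow> 'a ell2"
  is "\<lambda>T. pair_sum (case_nat (JT T) (\<lambda>_. J0))"
  by (rule summable_pair_sum_J0) (auto split: nat.split)

definition U0 :: "('a::complex_inner \<Rightarrow> 'a) \<Rightarrow> 'a ell2 \<Rightarrow> 'a ell2"
  where "U0 T = L0 T \<circ> M0"

definition U0_tilde :: "('a::complex_inner \<Rightarrow> 'a) \<Rightarrow> 'a ell2 \<Rightarrow> 'a ell2"
  where "U0_tilde T = M0 \<circ> L0 T"

end

theory Submission
  imports Defs
begin

text \<open>
  The operators are made of two symmetric pieces. \<open>M0\<close> exchanges neighbouring entries, so it is an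
  involution. \<open>L0 T\<close> is inverted by \<open>L0 T\<^sup>*\<close>, because the block \<open>JT T\<close> is inverted by
  \<open>JT T\<^sup>*\<close>: expanding the product of the two blocks uses only \<open>D\<^sup>2 = I - T\<^sup>* T\<close>,
  \<open>D\<^sub>*\<^sup>2 = I - T T\<^sup>*\<close> and the intertwining relations \<open>T D = D\<^sub>* T\<close> and \<open>T\<^sup>* D\<^sub>* = D T\<^sup>*\<close>, where \<open>D\<close>
  and \<open>D\<^sub>*\<close> are the defect operators of \<open>T\<close> and of \<open>T\<^sup>*\<close>. The same relations make \<open>L0 T\<close>
  isometric. Hence \<open>U0 T\<close> is unitary on the whole sequence space, with inverse \<open>M0 \<circ> L0 T\<^sup>*\<close>, and
  it remains to see that the subspaces are respected (\<open>L0_mem_H0\<close>).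

  In coordinates \<open>U0 T\<close> sends \<open>f\<close> to
  \<open>(T f\<^sub>0 + D\<^sub>* f\<^sub>2, D f\<^sub>0 - T\<^sup>* f\<^sub>2, f\<^sub>4, f\<^sub>1, f\<^sub>6, f\<^sub>3, \<dots>)\<close>: odd entries move outwards and
  even entries move inwards. For a vector of \<open>H\<close> the even entries from \<open>2\<close> on are zero, and they stay
  zero under \<open>U0 T\<close>; therefore \<open>U0 T\<close> acts on the entry \<open>0\<close> as \<open>T\<close>, which is the dilation
  property (\<open>U0_pow_embed_H\<close>). For minimality, write \<open>e\<^sub>n x\<close> for the sequence with the single entry
  \<open>x\<close> at \<open>n\<close>. One forward step from \<open>e\<^sub>0 z\<close> produces \<open>e\<^sub>1 (D z)\<close> up to an element of \<open>H\<close>, and further steps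
  push it to all odd entries; one backward step likewise produces \<open>e\<^sub>2 (D\<^sub>* z)\<close>, and further steps push it to
  all even entries. Thus the closed span of the orbit of \<open>H\<close> contains every summand.

  The second dilation follows from the first: \<open>M0 \<circ> U0 T = U0_tilde T \<circ> M0\<close>, \<open>M0\<close> is unitary
  from \<open>H0 T\<close> to \<open>H0_tilde T\<close> and fixes \<open>H\<close>, and minimal unitary dilations can be transported along such
  an equivalence (\<open>minimal_unitary_dilation_transport\<close>).

  The adjoint, the square root and the projection are given by definite descriptions, so their
  existence and uniqueness are established first: adjoints come from the Riesz representation
  theorem, and the projection onto the range of an isometry \<open>V\<close> is \<open>V V\<^sup>*\<close>. The square root of
  \<open>I - X\<close>, for a contraction \<open>X\<close>, is \<open>I - Y\<close> with \<open>Y\<close> the limit of the iteration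
  \<open>Y\<^sub>n\<^sub>+\<^sub>1 = (X + Y\<^sub>n\<^sup>2) / 2\<close> from \<open>Y\<^sub>0 = 0\<close>. A relation \<open>S X = X' S\<close> passes to each \<open>Y\<^sub>n\<close> and to the limit; this one
  observation gives both the intertwining relations above and, with \<open>X = X'\<close>, the commutation
  on which the uniqueness of the square root rests.
\<close>

section \<open>Complex inner product spaces\<close>

instance chilbert_space \<subseteq> banach ..

lemma clinearI:
  fixes f :: "'a::complex_inner \<Rightarrow> 'b::complex_inner"
  assumes "\<And>x y. f (x + y) = f x + f y" "\<And>c x. f (c *\<^sub>C x) = c *\<^sub>C f x"
  shows "clinear f"
  by unfold_locales (use assms in \<open>auto simp: scaleC_add_right scaleC_add_left scaleC_scaleC\<close>)

lemma clinear_add: "clinear f \<Longrightarrow> f (x + y) = f x + f y"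
  and clinear_scaleC: "clinear f \<Longrightarrow> f (c *\<^sub>C x) = c *\<^sub>C f x"
  by (simp_all add: Vector_Spaces.linear_iff)

lemma clinear_zero: "clinear f \<Longrightarrow> f 0 = 0"
  using clinear_scaleC[of f 0 0] by simp

lemma clinear_minus: "clinear f \<Longrightarrow> f (- x) = - f x"
  using clinear_scaleC[of f "-1" x] by simp

lemma clinear_diff: "clinear f \<Longrightarrow> f (x - y) = f x - f y"
  using clinear_add[of f x "- y"] by (simp add: clinear_minus)

lemma clinear_scaleR: "clinear f \<Longrightarrow> f (r *\<^sub>R x) = r *\<^sub>R f x"
  using clinear_scaleC[of f "of_real r" x] by (simp only: scaleC_of_real)

lemma scaleC_scaleR_commute: "c *\<^sub>C r *\<^sub>R x = r *\<^sub>R c *\<^sub>C x"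
  for x :: "'a::complex_inner"
  by (simp add: scaleC_of_real[symmetric] scaleC_scaleC mult.commute)

lemma bounded_linear_scaleC: "bounded_linear (\<lambda>x::'a::complex_inner. c *\<^sub>C x)"
  by (rule bounded_linear_intro[where K = "norm c"])
    (simp_all add: scaleC_add_right scaleC_scaleR_commute norm_scaleC mult.commute)

lemma clinear_imp_bounded_linear:
  assumes "clinear f" "\<And>x. norm (f x) \<le> K * norm x"
  shows "bounded_linear f"
  by (rule bounded_linear_intro[where K = K])
    (use assms in \<open>simp_all add: clinear_add clinear_scaleR mult.commute\<close>)

lemma bounded_clinear_imp_bounded_linear: "bounded_clinear f \<Longrightarrow> bounded_linear f"
  unfolding bounded_clinear_def using clinear_imp_bounded_linear by blast

lemma contraction_imp_bounded_clinear: "contraction T \<Longrightarrow> bounded_clinear T"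
  unfolding contraction_def bounded_clinear_def by (metis mult_1)

lemma cinner_add_right: "cinner x (y + z) = cinner x y + cinner x z"
  for x :: "'a::complex_inner"
  by (metis cinner_add_left cinner_commute complex_cnj_add)

lemma cinner_scaleC_right: "cinner x (c *\<^sub>C y) = cnj c * cinner x y"
  for x :: "'a::complex_inner"
  by (metis cinner_commute cinner_scaleC_left complex_cnj_mult)

lemma cinner_minus_left [simp]: "cinner (- x) y = - cinner x y"
  for x :: "'a::complex_inner"
  using cinner_scaleC_left[of "-1" x y] by simp

lemma cinner_minus_right [simp]: "cinner x (- y) = - cinner x y"
  for x :: "'a::complex_inner"
  using cinner_scaleC_right[of x "-1" y] by simp

lemma cinner_diff_left: "cinner (x - y) z = cinner x z - cinner y z"
  for x :: "'a::complex_inner"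
  using cinner_add_left[of x "- y" z] by simp

lemma cinner_diff_right: "cinner x (y - z) = cinner x y - cinner x z"
  for x :: "'a::complex_inner"
  using cinner_add_right[of x y "- z"] by simp

lemma cinner_zero_left [simp]: "cinner 0 y = 0"
  for y :: "'a::complex_inner"
  using cinner_scaleC_left[of 0 0 y] by simp

lemma cinner_zero_right [simp]: "cinner y 0 = 0"
  for y :: "'a::complex_inner"
  using cinner_scaleC_right[of y 0 0] by simp

lemma cinner_scaleR_left: "cinner (r *\<^sub>R x) y = of_real r * cinner x y"
  for x :: "'a::complex_inner"
  by (simp add: scaleC_of_real[symmetric] cinner_scaleC_left)

lemma cinner_scaleR_right: "cinner x (r *\<^sub>R y) = of_real r * cinner x y"
  for x :: "'a::complex_inner"
  by (simp add: scaleC_of_real[symmetric] cinner_scaleC_right)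

lemmas cinner_simps = cinner_add_left cinner_add_right cinner_diff_left cinner_diff_right
  cinner_scaleC_left cinner_scaleC_right cinner_scaleR_left cinner_scaleR_right

lemma cinner_eqI:
  fixes a b :: "'a::complex_inner"
  assumes "\<And>x. cinner x a = cinner x b"
  shows "a = b"
proof -
  have "cinner (a - b) (a - b) = 0"
    using assms by (simp add: cinner_diff_right)
  then show ?thesis
    by (simp add: cinner_self_eq)
qed

lemma bounded_linear_cinner_left: "bounded_linear (\<lambda>x::'a::complex_inner. cinner x y)"
  by (rule bounded_linear_intro[where K = "2 * norm y"])
    (use norm_cinner_le[of _ y] in
      \<open>simp_all add: cinner_add_left cinner_scaleR_left scaleR_conv_of_real mult_ac\<close>)

lemma bounded_linear_cinner_right: "bounded_linear (\<lambda>y::'a::complex_inner. cinner x y)"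
  by (rule bounded_linear_intro[where K = "2 * norm x"])
    (use norm_cinner_le[of x] in
      \<open>simp_all add: cinner_add_right cinner_scaleR_right scaleR_conv_of_real mult_ac\<close>)

section \<open>Adjoints\<close>

text \<open>The representing vector minimises \<open>J x = \<parallel>x\<parallel>\<^sup>2 - 2 \<phi> x\<close>, which is the squared distance to that
  vector up to a constant. By the parallelogram law every minimising sequence is Cauchy, and the
  first-order condition at the minimum is the representation.\<close>

lemma riesz_representation_real:
  fixes \<phi> :: "'a::{real_inner,complete_space} \<Rightarrow> real"
  assumes "bounded_linear \<phi>"
  shows "\<exists>z. \<forall>x. \<phi> x = inner x z"
proof -
  interpret \<phi>: bounded_linear \<phi> by fact
  obtain K where K: "\<And>x. norm (\<phi> x) \<le> norm x * K"
    using \<phi>.bounded by blast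
  define J where "J x = (norm x)\<^sup>2 - 2 * \<phi> x" for x
  have parallelogram: "(norm (x - y))\<^sup>2 / 2 = J x + J y - 2 * J ((1/2) *\<^sub>R (x + y))" for x y
    by (simp add: J_def \<phi>.add \<phi>.scaleR power2_norm_eq_inner inner_add inner_diff inner_commute field_simps)
  have "J x \<ge> - K\<^sup>2" for x
  proof -
    have "\<phi> x \<le> norm x * K"
      using K[of x] by simp
    then show ?thesis
      using sum_squares_bound[of "norm x" K] unfolding J_def
      by (simp add: power2_eq_square algebra_simps)
  qed
  then have bdd: "bdd_below (range J)"
    by (auto simp: bdd_below_def)
  define m where "m = (INF x. J x)"
  have m_le: "m \<le> J x" for x
    unfolding m_def using bdd by (rule cINF_lower) simp
  have "\<exists>x. J x < m + 1 / real (Suc n)" for n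
    using cINF_less_iff[OF _ bdd, of "m + 1 / real (Suc n)"] by (simp add: m_def)
  then obtain u where u: "\<And>n. J (u n) < m + 1 / real (Suc n)"
    by metis
  have "Cauchy u"
  proof (rule metric_CauchyI)
    fix e :: real assume "0 < e"
    then obtain N where N: "1 / real (Suc N) < e\<^sup>2 / 4"
      by (metis nat_approx_posE divide_pos_pos zero_less_numeral zero_less_power)
    have "dist (u k) (u l) < e" if "k \<ge> N" "l \<ge> N" for k l
    proof -
      have "1 / real (Suc k) \<le> 1 / real (Suc N)" "1 / real (Suc l) \<le> 1 / real (Suc N)"
        using that by (auto intro!: divide_left_mono)
      then have "(norm (u k - u l))\<^sup>2 / 2 < e\<^sup>2 / 2"
        using parallelogram[of "u k" "u l"] u[of k] u[of l] m_le[of "(1/2) *\<^sub>R (u k + u l)"] N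
        by linarith
      then show ?thesis
        using \<open>0 < e\<close> by (simp add: dist_norm power2_less_imp_less)
    qed
    then show "\<exists>N. \<forall>k\<ge>N. \<forall>l\<ge>N. dist (u k) (u l) < e" by blast
  qed
  then obtain z where z: "u \<longlonglongrightarrow> z"
    using Cauchy_convergent convergent_def by blast
  have "J z \<le> m"
  proof (rule LIMSEQ_le)
    show "(\<lambda>n. J (u n)) \<longlonglongrightarrow> J z"
      unfolding J_def by (intro tendsto_intros \<phi>.tendsto z)
    show "(\<lambda>n. m + 1 / real (Suc n)) \<longlonglongrightarrow> m"
      using tendsto_add[OF tendsto_const[of m] LIMSEQ_inverse_real_of_nat]
      by (simp add: inverse_eq_divide)
  qed (use u less_imp_le in blast)
  have "\<phi> h = inner h z" for h
  proof (rule ccontr)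
    assume ne: "\<phi> h \<noteq> inner h z"
    then have h: "inner h h > 0"
      using \<phi>.zero by (metis inner_gt_zero_iff inner_zero_left)
    define a where "a = inner h z - \<phi> h"
    \<comment> \<open>The minimiser of the quadratic polynomial \<open>t \<mapsto> J (z + t h)\<close>.\<close>
    define t where "t = - (a / inner h h)"
    have "J (z + t *\<^sub>R h) = J z + 2 * t * a + t\<^sup>2 * inner h h"
      unfolding J_def a_def power2_norm_eq_inner
      by (simp add: \<phi>.add \<phi>.scaleR inner_add inner_commute power2_eq_square algebra_simps)
    also have "\<dots> = J z - a\<^sup>2 / inner h h"
      using h by (simp add: t_def field_simps power2_eq_square)
    also have "\<dots> < J z"
      using h ne by (simp add: a_def)
    finally show False
      using m_le[of "z + t *\<^sub>R h"] \<open>J z \<le> m\<close> by linarith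
  qed
  then show ?thesis by blast
qed

text \<open>The real Riesz theorem represents the real part of \<open>\<langle>T x, y\<rangle>\<close>; replacing \<open>x\<close> by \<open>\<i> x\<close> shows that
  the imaginary parts agree as well.\<close>

lemma ex_adjoint:
  fixes T :: "'a::chilbert_space \<Rightarrow> 'b::complex_inner"
  assumes "bounded_clinear T"
  shows "\<exists>z. \<forall>x. cinner (T x) y = cinner x z"
proof -
  have T: "clinear T"
    using assms by (simp add: bounded_clinear_def)
  have "bounded_linear (\<lambda>x. Re (cinner (T x) y))"
    using bounded_linear_compose[OF bounded_linear_Re
        bounded_linear_compose[OF bounded_linear_cinner_left
          bounded_clinear_imp_bounded_linear[OF assms]]] .
  then obtain z where z: "Re (cinner (T x) y) = Re (cinner x z)" for x
    using riesz_representation_real[of "\<lambda>x. Re (cinner (T x) y)"] unfolding inner_eq_Re_cinner by blast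
  have "Im (cinner (T x) y) = Im (cinner x z)" for x
    using z[of "\<i> *\<^sub>C x"] by (simp add: clinear_scaleC[OF T] cinner_scaleC_left)
  then show ?thesis
    using z complex_eq_iff by blast
qed

lemma cadjoint_eqI:
  assumes "\<And>x y. cinner (T x) y = cinner x (S y)"
  shows "cadjoint T = S"
  unfolding cadjoint_def
proof (rule the_equality)
  fix S' assume "\<forall>x y. cinner (T x) y = cinner x (S' y)"
  then show "S' = S"
    using assms by (intro ext cinner_eqI) metis
qed (use assms in blast)

lemma cinner_cadjoint:
  fixes T :: "'a::chilbert_space \<Rightarrow> 'b::complex_inner"
  assumes "bounded_clinear T"
  shows "cinner (T x) y = cinner x (cadjoint T y)"
proof -
  obtain S where "\<And>x y. cinner (T x) y = cinner x (S y)"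
    using ex_adjoint[OF assms] by metis
  then show ?thesis
    using cadjoint_eqI[of T S] by simp
qed

lemma cinner_cadjoint':
  fixes T :: "'a::chilbert_space \<Rightarrow> 'b::complex_inner"
  assumes "bounded_clinear T"
  shows "cinner (cadjoint T y) x = cinner y (T x)"
  by (metis assms cinner_cadjoint cinner_commute)

lemma cadjoint_cadjoint:
  fixes T :: "'a::chilbert_space \<Rightarrow> 'b::complex_inner"
  assumes "bounded_clinear T"
  shows "cadjoint (cadjoint T) = T"
  by (rule cadjoint_eqI) (rule cinner_cadjoint'[OF assms])

lemma clinear_cadjoint:
  fixes T :: "'a::chilbert_space \<Rightarrow> 'b::complex_inner"
  assumes "bounded_clinear T"
  shows "clinear (cadjoint T)"
proof (rule clinearI; rule cinner_eqI)
  fix w y z c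
  show "cinner w (cadjoint T (y + z)) = cinner w (cadjoint T y + cadjoint T z)"
    "cinner w (cadjoint T (c *\<^sub>C y)) = cinner w (c *\<^sub>C cadjoint T y)"
    by (simp_all add: cinner_simps flip: cinner_cadjoint[OF assms])
qed

text \<open>\<open>\<parallel>T\<^sup>* y\<parallel>\<^sup>2 = \<langle>T T\<^sup>* y, y\<rangle> \<le> \<parallel>T\<^sup>* y\<parallel> \<parallel>y\<parallel>\<close>.\<close>

lemma contraction_cadjoint:
  fixes T :: "'a::chilbert_space \<Rightarrow> 'b::complex_inner"
  assumes "contraction T"
  shows "contraction (cadjoint T)"
  unfolding contraction_def
proof (intro conjI allI)
  note b = contraction_imp_bounded_clinear[OF assms]
  show "clinear (cadjoint T)"
    by (rule clinear_cadjoint[OF b])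
  fix y
  have "(norm (cadjoint T y))\<^sup>2 = inner (T (cadjoint T y)) y"
    using cinner_cadjoint[OF b, of "cadjoint T y" y]
    by (simp add: power2_norm_eq_inner inner_eq_Re_cinner)
  also have "\<dots> \<le> norm (T (cadjoint T y)) * norm y"
    by (rule norm_cauchy_schwarz)
  also have "\<dots> \<le> norm (cadjoint T y) * norm y"
    using assms by (simp add: contraction_def mult_right_mono)
  finally show "norm (cadjoint T y) \<le> norm y"
    by (cases "cadjoint T y = 0") (simp_all add: power2_eq_square)
qed

section \<open>The square root of \<open>I - X\<close> for a contraction \<open>X\<close>\<close>

text \<open>If \<open>Y = (X + Y\<^sup>2) / 2\<close>, then \<open>(I - Y)\<^sup>2 = I - X\<close>. The iteration for this fixed point is dominated by
  the same iteration for the number \<open>1\<close> in place of \<open>X\<close>, called \<open>root_bound\<close>, which is increasing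
  and bounded by \<open>1\<close>; this makes it converge even when \<open>\<parallel>X\<parallel> = 1\<close>.\<close>

primrec root_iter :: "('a::complex_inner \<Rightarrow> 'a) \<Rightarrow> nat \<Rightarrow> 'a \<Rightarrow> 'a" where
  "root_iter X 0 = (\<lambda>v. 0)"
| "root_iter X (Suc n) = (\<lambda>v. (1/2) *\<^sub>R (X v + root_iter X n (root_iter X n v)))"

primrec root_bound :: "nat \<Rightarrow> real" where
  "root_bound 0 = 0"
| "root_bound (Suc n) = (1 + (root_bound n)\<^sup>2) / 2"

definition root_compl :: "('a::complex_inner \<Rightarrow> 'a) \<Rightarrow> 'a \<Rightarrow> 'a"
  where "root_compl X v = v - lim (\<lambda>n. root_iter X n v)"

lemma root_bound_01: "0 \<le> root_bound n \<and> root_bound n \<le> 1"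
proof (induction n)
  case (Suc n)
  then have "(root_bound n)\<^sup>2 \<le> 1"
    by (simp add: power_le_one)
  then show ?case by simp
qed simp

lemma root_bound_Suc_ge: "root_bound n \<le> root_bound (Suc n)"
  using sum_squares_bound[of "root_bound n" 1] by simp

lemma clinear_root_iter:
  assumes "clinear X"
  shows "clinear (root_iter X n)"
proof (induction n)
  case (Suc n)
  then show ?case
    using assms by (intro clinearI)
      (simp_all add: clinear_add clinear_scaleC scaleR_add_right scaleC_scaleR_commute
        scaleC_add_right)
qed (simp add: clinearI)

lemma norm_root_iter_le:
  assumes "contraction X"
  shows "norm (root_iter X n v) \<le> root_bound n * norm v"
proof (induction n arbitrary: v)
  case (Suc n)
  have "norm (root_iter X n (root_iter X n v)) \<le> root_bound n * (root_bound n * norm v)"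
    using Suc[of "root_iter X n v"] mult_left_mono[OF Suc[of v], of "root_bound n"] root_bound_01[of n]
    by linarith
  moreover have "norm (X v) \<le> norm v"
    using assms by (simp add: contraction_def)
  ultimately show ?case
    using norm_triangle_ineq[of "X v" "root_iter X n (root_iter X n v)"]
    unfolding root_iter.simps root_bound.simps norm_scaleR
    by (simp add: power2_eq_square algebra_simps)
qed simp

text \<open>The difference of consecutive iterates obeys the same recursion as the difference of
  consecutive bounds, through \<open>p\<^sup>2 - q\<^sup>2 = p (p - q) + (p - q) q\<close>.\<close>

lemma norm_root_iter_diff_le:
  assumes "contraction X"
  shows "norm (root_iter X (Suc n) v - root_iter X n v)
    \<le> (root_bound (Suc n) - root_bound n) * norm v"
proof (induction n arbitrary: v)
  case 0
  show ?case
    using norm_root_iter_le[OF assms, of 1 v] by simp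
next
  case (Suc n)
  have lin: "clinear (root_iter X k)" for k
    using assms by (simp add: contraction_def clinear_root_iter)
  define P Q where "P = root_iter X (Suc n)" and "Q = root_iter X n"
  define p q where "p = root_bound (Suc n)" and "q = root_bound n"
  have pq: "0 \<le> p" "q \<le> p" "0 \<le> q"
    using root_bound_01 root_bound_Suc_ge by (simp_all add: p_def q_def del: root_bound.simps)
  have IH: "norm (P w - Q w) \<le> (p - q) * norm w" for w
    using Suc by (simp add: P_def Q_def p_def q_def)
  have eq: "root_iter X (Suc (Suc n)) v - root_iter X (Suc n) v
    = (1/2) *\<^sub>R (P (P v - Q v) + (P (Q v) - Q (Q v)))"
  proof -
    have "root_iter X (Suc (Suc n)) v = (1/2) *\<^sub>R (X v + P (P v))"
      by (simp only: root_iter.simps(2)[of X "Suc n"] P_def)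
    moreover have "root_iter X (Suc n) v = (1/2) *\<^sub>R (X v + Q (Q v))"
      by (simp only: root_iter.simps(2)[of X n] Q_def)
    moreover have "P (P v - Q v) = P (P v) - P (Q v)"
      unfolding P_def by (rule clinear_diff[OF lin])
    ultimately show ?thesis
      by (simp add: scaleR_diff_right scaleR_add_right)
  qed
  have "norm (P (P v - Q v)) \<le> p * ((p - q) * norm v)"
    using norm_root_iter_le[OF assms, of "Suc n" "P v - Q v"] mult_left_mono[OF IH[of v] pq(1)]
    unfolding P_def[symmetric] p_def[symmetric] by linarith
  moreover have "norm (P (Q v) - Q (Q v)) \<le> (p - q) * (q * norm v)"
    using IH[of "Q v"] mult_left_mono[OF norm_root_iter_le[OF assms, of n v], of "p - q"] pq
    unfolding Q_def[symmetric] q_def[symmetric] by linarith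
  ultimately have sum: "norm (P (P v - Q v) + (P (Q v) - Q (Q v))) \<le> (p\<^sup>2 - q\<^sup>2) * norm v"
    using norm_triangle_ineq[of "P (P v - Q v)" "P (Q v) - Q (Q v)"]
    by (simp add: power2_eq_square algebra_simps)
  have bound: "root_bound (Suc (Suc n)) - root_bound (Suc n) = (p\<^sup>2 - q\<^sup>2) / 2"
    by (simp only: root_bound.simps(2)[of "Suc n"] p_def[symmetric])
      (simp add: p_def q_def diff_divide_distrib add_divide_distrib)
  show ?case
    unfolding eq bound norm_scaleR using sum by simp
qed

text \<open>The increments are dominated by the telescoping, hence summable, increments of the bounds.\<close>

lemma root_iter_tendsto:
  fixes X :: "'a::chilbert_space \<Rightarrow> 'a"
  assumes "contraction X"
  shows "(\<lambda>n. root_iter X n v) \<longlonglongrightarrow> v - root_compl X v"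
proof -
  have "incseq root_bound"
    by (rule incseq_SucI) (rule root_bound_Suc_ge)
  then have "convergent root_bound"
    using root_bound_01 by (metis Bseq_mono_convergent BseqI' real_norm_def abs_of_nonneg incseq_def)
  then have "summable (\<lambda>n. root_bound (Suc n) - root_bound n)"
    by (metis convergent_def telescope_summable)
  then have "summable (\<lambda>n. (root_bound (Suc n) - root_bound n) * norm v)"
    by (rule summable_mult2)
  then have "summable (\<lambda>n. root_iter X (Suc n) v - root_iter X n v)"
    by (rule summable_comparison_test'[where N = 0]) (rule norm_root_iter_diff_le[OF assms])
  then obtain l where "(\<lambda>n. root_iter X (Suc n) v - root_iter X n v) sums l"
    by (auto simp: summable_def)
  then have "(\<lambda>n. root_iter X n v) \<longlonglongrightarrow> l"
    using sum_lessThan_telescope[of "\<lambda>n. root_iter X n v"]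
    unfolding sums_def by (simp del: root_iter.simps(2))
  then show ?thesis
    by (metis root_compl_def limI diff_diff_eq2 add_diff_cancel_left')
qed

lemma clinear_root_compl:
  fixes X :: "'a::chilbert_space \<Rightarrow> 'a"
  assumes "contraction X"
  shows "clinear (root_compl X)"
proof -
  note lim = root_iter_tendsto[OF assms]
  have lin: "clinear (root_iter X n)" for n
    using assms by (simp add: contraction_def clinear_root_iter)
  show ?thesis
  proof (rule clinearI)
    fix v w c
    have "(\<lambda>n. root_iter X n (v + w)) \<longlonglongrightarrow> (v - root_compl X v) + (w - root_compl X w)"
      unfolding clinear_add[OF lin] by (intro tendsto_add lim)
    then have "v + w - root_compl X (v + w) = (v - root_compl X v) + (w - root_compl X w)"
      using lim LIMSEQ_unique by blast
    then show "root_compl X (v + w) = root_compl X v + root_compl X w"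
      by (simp add: algebra_simps)
    have "(\<lambda>n. root_iter X n (c *\<^sub>C v)) \<longlonglongrightarrow> c *\<^sub>C (v - root_compl X v)"
      unfolding clinear_scaleC[OF lin]
      by (intro bounded_linear.tendsto[OF bounded_linear_scaleC] lim)
    then have "c *\<^sub>C v - root_compl X (c *\<^sub>C v) = c *\<^sub>C (v - root_compl X v)"
      using lim LIMSEQ_unique by blast
    then show "root_compl X (c *\<^sub>C v) = c *\<^sub>C root_compl X v"
      by (simp add: complex_vector.scale_right_diff_distrib)
  qed
qed

lemma contraction_id_minus_root_compl:
  fixes X :: "'a::chilbert_space \<Rightarrow> 'a"
  assumes "contraction X"
  shows "norm (v - root_compl X v) \<le> norm v"
proof (rule Lim_bounded)
  show "(\<lambda>n. norm (root_iter X n v)) \<longlonglongrightarrow> norm (v - root_compl X v)"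
    by (intro tendsto_norm root_iter_tendsto assms)
  show "\<forall>n\<ge>0. norm (root_iter X n v) \<le> norm v"
    using norm_root_iter_le[OF assms, of _ v] root_bound_01 mult_left_le_one_le[OF norm_ge_zero]
    by (meson order_trans)
qed

lemma bounded_clinear_root_compl:
  fixes X :: "'a::chilbert_space \<Rightarrow> 'a"
  assumes "contraction X"
  shows "bounded_clinear (root_compl X)"
  unfolding bounded_clinear_def
proof (intro conjI exI allI)
  show "clinear (root_compl X)"
    by (rule clinear_root_compl[OF assms])
  fix v
  have "norm (root_compl X v) \<le> norm v + norm (v - root_compl X v)"
    using norm_triangle_ineq4[of v "v - root_compl X v"] by simp
  then show "norm (root_compl X v) \<le> 2 * norm v"
    using contraction_id_minus_root_compl[OF assms, of v] by simp
qed

lemma root_compl_root_compl: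
  fixes X :: "'a::chilbert_space \<Rightarrow> 'a"
  assumes "contraction X"
  shows "root_compl X (root_compl X v) = v - X v"
proof -
  define Y where "Y w = w - root_compl X w" for w
  have lim: "(\<lambda>n. root_iter X n w) \<longlonglongrightarrow> Y w" for w
    using root_iter_tendsto[OF assms] by (simp add: Y_def)
  have lin: "clinear (root_iter X n)" for n
    using assms by (simp add: contraction_def clinear_root_iter)
  have "(\<lambda>n. root_iter X n (root_iter X n v) - root_iter X n (Y v)) \<longlonglongrightarrow> 0"
  proof (rule Lim_null_comparison)
    have "norm (root_iter X n (root_iter X n v) - root_iter X n (Y v)) \<le> norm (root_iter X n v - Y v)"
      for n
      unfolding clinear_diff[OF lin, symmetric]
      using norm_root_iter_le[OF assms] root_bound_01 mult_left_le_one_le[OF norm_ge_zero]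
      by (meson order_trans)
    then show "\<forall>\<^sub>F n in sequentially.
        norm (root_iter X n (root_iter X n v) - root_iter X n (Y v)) \<le> norm (root_iter X n v - Y v)"
      by simp
    show "(\<lambda>n. norm (root_iter X n v - Y v)) \<longlonglongrightarrow> 0"
      using lim by (simp add: LIM_zero tendsto_norm_zero)
  qed
  then have "(\<lambda>n. root_iter X n (root_iter X n v)) \<longlonglongrightarrow> Y (Y v)"
    using tendsto_add[OF _ lim[of "Y v"]] by fastforce
  then have "(\<lambda>n. root_iter X (Suc n) v) \<longlonglongrightarrow> (1/2) *\<^sub>R (X v + Y (Y v))"
    unfolding root_iter.simps by (intro tendsto_intros)
  then have "Y v = (1/2) *\<^sub>R (X v + Y (Y v))"
    using LIMSEQ_unique LIMSEQ_Suc lim by blast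
  then have "2 *\<^sub>R Y v = X v + Y (Y v)"
    by (metis scaleR_scaleR scaleR_one nonzero_mult_div_cancel_left times_divide_eq_right mult_1_right zero_neq_numeral)
  then show ?thesis
    by (simp add: Y_def clinear_diff[OF clinear_root_compl[OF assms]] algebra_simps scaleR_2)
qed

text \<open>Each iterate is a polynomial in \<open>X\<close>, so the relation passes to the iterates and then to the limit.
  For \<open>X = X'\<close> it says that the root commutes with everything that commutes with \<open>X\<close>.\<close>

lemma root_compl_intertwine:
  fixes X :: "'a::chilbert_space \<Rightarrow> 'a" and X' :: "'b::chilbert_space \<Rightarrow> 'b"
  assumes "contraction X" "contraction X'" "bounded_clinear S" "\<And>v. S (X v) = X' (S v)"
  shows "S (root_compl X v) = root_compl X' (S v)"
proof -
  have S: "clinear S" "bounded_linear S"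
    using assms(3) bounded_clinear_imp_bounded_linear by (auto simp: bounded_clinear_def)
  have "S (root_iter X n v) = root_iter X' n (S v)" for n
    by (induction n arbitrary: v)
      (simp_all add: clinear_zero[OF S(1)] clinear_scaleR[OF S(1)] clinear_add[OF S(1)] assms(4))
  then have "(\<lambda>n. root_iter X' n (S v)) \<longlonglongrightarrow> S (v - root_compl X v)"
    using bounded_linear.tendsto[OF S(2) root_iter_tendsto[OF assms(1), of v]] by simp
  then have "S v - root_compl X' (S v) = S (v - root_compl X v)"
    using root_iter_tendsto[OF assms(2)] LIMSEQ_unique by blast
  then show ?thesis
    by (simp add: clinear_diff[OF S(1)])
qed

lemma root_compl_selfadjoint:
  fixes X :: "'a::chilbert_space \<Rightarrow> 'a"
  assumes "contraction X" and sa: "\<And>v w. cinner (X v) w = cinner v (X w)"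
  shows "cinner (root_compl X v) w = cinner v (root_compl X w)"
proof -
  note lim = root_iter_tendsto[OF assms(1)]
  have "cinner (root_iter X n v) w = cinner v (root_iter X n w)" for n v w
    by (induction n arbitrary: v w)
      (simp_all add: cinner_scaleR_left cinner_scaleR_right cinner_add_left cinner_add_right sa)
  then have "(\<lambda>n. cinner (root_iter X n v) w) \<longlonglongrightarrow> cinner v (w - root_compl X w)"
    using bounded_linear.tendsto[OF bounded_linear_cinner_right lim[of w], of v] by simp
  then have "cinner (v - root_compl X v) w = cinner v (w - root_compl X w)"
    using bounded_linear.tendsto[OF bounded_linear_cinner_left lim[of v], of w] LIMSEQ_unique by blast
  then show ?thesis
    by (simp add: cinner_diff_left cinner_diff_right)
qed

text \<open>\<open>\<langle>(I - Y) v, v\<rangle> = \<parallel>v\<parallel>\<^sup>2 - \<langle>Y v, v\<rangle>\<close>, and \<open>Y\<close> is a contraction.\<close>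

lemma root_compl_nonneg:
  fixes X :: "'a::chilbert_space \<Rightarrow> 'a"
  assumes "contraction X" "\<And>v w. cinner (X v) w = cinner v (X w)"
  shows "cinner (root_compl X v) v \<in> \<real>\<^sub>\<ge>\<^sub>0"
proof -
  have "inner (v - root_compl X v) v \<le> norm (v - root_compl X v) * norm v"
    by (rule norm_cauchy_schwarz)
  also have "\<dots> \<le> inner v v"
    using mult_right_mono[OF contraction_id_minus_root_compl[OF assms(1), of v] norm_ge_zero[of v]]
    by (simp flip: power2_norm_eq_inner power2_eq_square)
  finally have "0 \<le> Re (cinner (root_compl X v) v)"
    by (simp add: inner_diff_left flip: inner_eq_Re_cinner)
  moreover have "cinner (root_compl X v) v = cnj (cinner (root_compl X v) v)"
    using root_compl_selfadjoint[OF assms, of v v] cinner_commute by metis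
  ultimately show ?thesis
    by (simp add: complex_nonneg_Reals_iff complex_eq_iff)
qed

text \<open>Polarisation: a complex form whose diagonal values are real is Hermitian, as one sees from its
  values at \<open>x + y\<close> and \<open>x + \<i> y\<close>.\<close>

lemma nonneg_imp_selfadjoint:
  fixes B :: "'a::complex_inner \<Rightarrow> 'a"
  assumes "clinear B" "\<And>x. cinner (B x) x \<in> \<real>\<^sub>\<ge>\<^sub>0"
  shows "cinner (B x) y = cinner x (B y)"
proof -
  have im: "Im (cinner (B x) x) = 0" for x
    using assms(2)[of x] by (simp add: complex_nonneg_Reals_iff)
  have "Im (cinner (B x) y) + Im (cinner (B y) x) = 0"
    using im[of "x + y"] im[of x] im[of y] by (simp add: clinear_add[OF assms(1)] cinner_simps)
  moreover have "Re (cinner (B x) y) = Re (cinner (B y) x)"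
    using im[of "x + \<i> *\<^sub>C y"] im[of x] im[of y]
    by (simp add: clinear_add[OF assms(1)] clinear_scaleC[OF assms(1)] cinner_simps)
  ultimately have "cinner (B x) y = cnj (cinner (B y) x)"
    by (simp add: complex_eq_iff)
  then show ?thesis
    by (metis cinner_commute)
qed

lemma nonneg_kernel:
  fixes B :: "'a::complex_inner \<Rightarrow> 'a"
  assumes "bounded_clinear B" "\<And>x. cinner (B x) x \<in> \<real>\<^sub>\<ge>\<^sub>0" "cinner (B y) y = 0"
  shows "B y = 0"
proof (rule ccontr)
  assume "B y \<noteq> 0"
  have B: "clinear B"
    using assms(1) by (simp add: bounded_clinear_def)
  note sa = nonneg_imp_selfadjoint[OF B assms(2)]
  have nn: "0 \<le> Re (cinner (B x) x)" for x
    using assms(2)[of x] by (simp add: complex_nonneg_Reals_iff)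
  define z where "z = B y"
  define a where "a = (norm z)\<^sup>2"
  define b where "b = Re (cinner (B z) z)"
  have "a > 0" "b \<ge> 0"
    using \<open>B y \<noteq> 0\<close> nn by (simp_all add: a_def b_def z_def)
  \<comment> \<open>The form is nonnegative at \<open>t y - z\<close>, where it is linear in the real parameter \<open>t\<close>.\<close>
  have "0 \<le> b - 2 * t * a" for t :: real
  proof -
    have "cinner (B (t *\<^sub>R y - z)) (t *\<^sub>R y - z) = cinner (B z) z - 2 * of_real t * cinner z z"
      using sa[of z y] assms(3)
      by (simp add: clinear_diff[OF B] clinear_scaleR[OF B] cinner_simps z_def[symmetric] algebra_simps)
    then show ?thesis
      using nn[of "t *\<^sub>R y - z"] by (simp add: a_def b_def cinner_self_eq)
  qed
  from this[of "(b + 1) / (2 * a)"] show False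
    using \<open>a > 0\<close> by simp
qed

text \<open>Let \<open>B\<close> be another nonnegative root and \<open>C\<close> the constructed one. As \<open>B\<close> commutes with
  \<open>B\<^sup>2 = I - X\<close>, it commutes with \<open>C\<close>, so \<open>(B + C) (B - C) = B\<^sup>2 - C\<^sup>2 = 0\<close>. Hence on the range of
  \<open>B - C\<close> the two nonnegative forms add up to zero, both operators vanish there, and the
  selfadjoint operator \<open>B - C\<close> has square zero.\<close>

lemma op_sqrt_eq_root_compl:
  fixes X :: "'a::chilbert_space \<Rightarrow> 'a"
  assumes X: "contraction X" and sa: "\<And>v w. cinner (X v) w = cinner v (X w)"
  shows "op_sqrt (\<lambda>v. v - X v) = root_compl X"
  unfolding op_sqrt_def
proof (rule the_equality)
  let ?C = "root_compl X"
  show "bounded_clinear ?C \<and> (\<forall>x. cinner (?C x) x \<in> \<real>\<^sub>\<ge>\<^sub>0) \<and> ?C \<circ> ?C = (\<lambda>v. v - X v)"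
    using bounded_clinear_root_compl[OF X] root_compl_nonneg[OF X sa] root_compl_root_compl[OF X]
    by auto
  fix B
  assume B: "bounded_clinear B \<and> (\<forall>x. cinner (B x) x \<in> \<real>\<^sub>\<ge>\<^sub>0) \<and> B \<circ> B = (\<lambda>v. v - X v)"
  then have lB: "clinear B" and BB: "\<And>v. B (B v) = v - X v"
    by (auto simp: bounded_clinear_def fun_eq_iff)
  have lC: "clinear ?C"
    by (rule clinear_root_compl[OF X])
  have CC: "?C (?C v) = v - X v" for v
    by (rule root_compl_root_compl[OF X])
  have saB: "cinner (B x) y = cinner x (B y)" for x y
    using nonneg_imp_selfadjoint[OF lB] B by blast
  have "B (v - X v) = B v - X (B v)" for v
    using BB[of "B v"] BB[of v] by simp
  then have "B (X v) = X (B v)" for v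
    by (simp add: clinear_diff[OF lB])
  then have comm: "B (?C v) = ?C (B v)" for v
    using root_compl_intertwine[OF X X] B by blast
  show "B = ?C"
  proof
    fix x
    define y where "y = B x - ?C x"
    have "B y + ?C y = 0"
      by (simp add: y_def clinear_diff[OF lB] clinear_diff[OF lC] BB CC comm)
    then have "cinner (B y) y + cinner (?C y) y = 0"
      by (simp flip: cinner_add_left)
    moreover have "cinner (B y) y \<in> \<real>\<^sub>\<ge>\<^sub>0" "cinner (?C y) y \<in> \<real>\<^sub>\<ge>\<^sub>0"
      using B root_compl_nonneg[OF X sa] by auto
    ultimately have "cinner (B y) y = 0" "cinner (?C y) y = 0"
      by (auto simp: complex_nonneg_Reals_iff complex_eq_iff)
    then have "B y = 0" "?C y = 0"
      using nonneg_kernel B bounded_clinear_root_compl[OF X] root_compl_nonneg[OF X sa] by blast+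
    have "cinner y y = cinner x (B y) - cinner x (?C y)"
      by (subst y_def) (simp add: cinner_diff_left saB root_compl_selfadjoint[OF X sa])
    then show "B x = ?C x"
      using \<open>B y = 0\<close> \<open>?C y = 0\<close> by (simp add: cinner_self_eq y_def)
  qed
qed

section \<open>Defect operators\<close>

context
  fixes T :: "'h::chilbert_space \<Rightarrow> 'h"
  assumes T: "contraction T"
begin

lemma contraction_cadjoint_comp: "contraction (\<lambda>x. cadjoint T (T x))"
proof -
  note Ts = contraction_cadjoint[OF T]
  have "norm (cadjoint T (T x)) \<le> norm x" for x
    using T Ts unfolding contraction_def by (meson order_trans)
  then show ?thesis
    using T Ts unfolding contraction_def
    by (auto intro!: clinearI simp: clinear_add clinear_scaleC)
qed

lemma defect_op_eq: "defect_op T = root_compl (\<lambda>x. cadjoint T (T x))"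
  unfolding defect_op_def
  by (rule op_sqrt_eq_root_compl[OF contraction_cadjoint_comp])
    (simp add: contraction_imp_bounded_clinear[OF T] cinner_cadjoint cinner_cadjoint')

lemma clinear_defect_op: "clinear (defect_op T)"
  unfolding defect_op_eq by (rule clinear_root_compl[OF contraction_cadjoint_comp])

lemma defect_op_selfadjoint: "cinner (defect_op T x) y = cinner x (defect_op T y)"
  unfolding defect_op_eq
  by (rule root_compl_selfadjoint[OF contraction_cadjoint_comp])
    (simp add: contraction_imp_bounded_clinear[OF T] cinner_cadjoint cinner_cadjoint')

lemma defect_op_defect_op: "defect_op T (defect_op T x) = x - cadjoint T (T x)"
  unfolding defect_op_eq by (rule root_compl_root_compl[OF contraction_cadjoint_comp])

lemma defect_op_cadjoint: "defect_op (cadjoint T) = defect_op_adj T"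
  unfolding defect_op_def defect_op_adj_def
  by (simp add: cadjoint_cadjoint[OF contraction_imp_bounded_clinear[OF T]])

lemma defect_op_adj_cadjoint: "defect_op_adj (cadjoint T) = defect_op T"
  unfolding defect_op_def defect_op_adj_def
  by (simp add: cadjoint_cadjoint[OF contraction_imp_bounded_clinear[OF T]])

end

text \<open>From here on \<open>D\<close> and \<open>D\<^sub>*\<close> stand for the defect operators of \<open>T\<close> and of \<open>T\<^sup>*\<close>. Since
  \<open>T (T\<^sup>* T) = (T T\<^sup>*) T\<close>, the intertwining property of the square roots gives \<open>T D = D\<^sub>* T\<close>.
  Every fact about \<open>D\<^sub>*\<close> is the corresponding fact about \<open>D\<close>, read for \<open>T\<^sup>*\<close>.\<close>

lemma defect_op_intertwine:
  fixes T :: "'h::chilbert_space \<Rightarrow> 'h"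
  assumes T: "contraction T"
  shows "T (defect_op T x) = defect_op_adj T (T x)"
proof -
  note Ts = contraction_cadjoint[OF T]
  have TT: "cadjoint (cadjoint T) = T"
    by (rule cadjoint_cadjoint[OF contraction_imp_bounded_clinear[OF T]])
  show ?thesis
    unfolding defect_op_cadjoint[OF T, symmetric] defect_op_eq[OF T] defect_op_eq[OF Ts] TT
    by (rule root_compl_intertwine[OF contraction_cadjoint_comp[OF T]
          contraction_cadjoint_comp[OF Ts, unfolded TT] contraction_imp_bounded_clinear[OF T]]) simp
qed

context
  fixes T :: "'h::chilbert_space \<Rightarrow> 'h"
  assumes T: "contraction T"
begin

lemma defect_op_adj_intertwine: "cadjoint T (defect_op_adj T x) = defect_op T (cadjoint T x)"
  using defect_op_intertwine[OF contraction_cadjoint[OF T], of x]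
  by (simp add: defect_op_cadjoint[OF T] defect_op_adj_cadjoint[OF T])

lemma defect_op_adj_selfadjoint: "cinner (defect_op_adj T x) y = cinner x (defect_op_adj T y)"
  using defect_op_selfadjoint[OF contraction_cadjoint[OF T]] by (simp add: defect_op_cadjoint[OF T])

lemma defect_op_adj_defect_op_adj:
  "defect_op_adj T (defect_op_adj T x) = x - T (cadjoint T x)"
  using defect_op_defect_op[OF contraction_cadjoint[OF T], of x]
  by (simp add: defect_op_cadjoint[OF T] cadjoint_cadjoint[OF contraction_imp_bounded_clinear[OF T]])

lemma clinear_JT_entries:
  "clinear T" "clinear (cadjoint T)" "clinear (defect_op T)" "clinear (defect_op_adj T)"
  using T contraction_cadjoint[OF T] clinear_defect_op[OF T]
    clinear_defect_op[OF contraction_cadjoint[OF T]]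
  by (simp_all add: contraction_def defect_op_cadjoint[OF T])

end

section \<open>Closed subspaces and unitary operators between them\<close>

lemma csubspace_closure:
  fixes S :: "'a::complex_inner set"
  assumes S: "csubspace S"
  shows "csubspace (closure S)"
  unfolding complex_vector.subspace_def
proof (intro conjI ballI allI)
  show "0 \<in> closure S"
    using complex_vector.subspace_0[OF S] closure_subset by blast
next
  fix x y assume "x \<in> closure S" "y \<in> closure S"
  then obtain u v where "\<And>n. u n \<in> S" "u \<longlonglongrightarrow> x" "\<And>n. v n \<in> S" "v \<longlonglongrightarrow> y"
    unfolding closure_sequential by blast
  then have "\<And>n. u n + v n \<in> S" "(\<lambda>n. u n + v n) \<longlonglongrightarrow> x + y"
    using complex_vector.subspace_add[OF S] by (auto intro: tendsto_add)
  then show "x + y \<in> closure S"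
    unfolding closure_sequential by (intro exI[of _ "\<lambda>n. u n + v n"]) blast
next
  fix c x assume "x \<in> closure S"
  then obtain u where "\<And>n. u n \<in> S" "u \<longlonglongrightarrow> x"
    unfolding closure_sequential by blast
  then have "\<And>n. c *\<^sub>C u n \<in> S" "(\<lambda>n. c *\<^sub>C u n) \<longlonglongrightarrow> c *\<^sub>C x"
    using complex_vector.subspace_scale[OF S] bounded_linear.tendsto[OF bounded_linear_scaleC]
    by auto
  then show "c *\<^sub>C x \<in> closure S"
    unfolding closure_sequential by (intro exI[of _ "\<lambda>n. c *\<^sub>C u n"]) blast
qed

lemma unitary_betweenD:
  assumes "unitary_between K L U"
  shows "x \<in> K \<Longrightarrow> U x \<in> L" "inj_on U K" "U ` K = L"
    "x \<in> K \<Longrightarrow> y \<in> K \<Longrightarrow> U (x + y) = U x + U y"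
    "x \<in> K \<Longrightarrow> U (c *\<^sub>C x) = c *\<^sub>C U x"
    "x \<in> K \<Longrightarrow> y \<in> K \<Longrightarrow> cinner (U x) (U y) = cinner x y"
  using assms unfolding unitary_between_def bij_betw_def by blast+

lemma unitary_betweenI:
  fixes U :: "'a::complex_inner \<Rightarrow> 'b::complex_inner"
  assumes U: "clinear U" "\<And>x y. cinner (U x) (U y) = cinner x y"
    and maps: "\<And>x. x \<in> K \<Longrightarrow> U x \<in> L" "\<And>y. y \<in> L \<Longrightarrow> V y \<in> K" "\<And>y. U (V y) = y"
  shows "unitary_between K L U"
  unfolding unitary_between_def bij_betw_def
proof (intro conjI)
  show "inj_on U K"
  proof (rule inj_onI)
    fix x y assume "U x = U y"
    then have "cinner (x - y) (x - y) = 0"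
      using U(2)[of "x - y" "x - y"] by (simp add: clinear_diff[OF U(1)])
    then show "x = y"
      by (simp add: cinner_self_eq)
  qed
  show "U ` K = L"
    using maps by (metis image_eqI subsetI subset_antisym image_subsetI)
qed (use U in \<open>auto simp: clinear_add clinear_scaleC\<close>)

lemma unitary_between_comp:
  assumes "unitary_between K L U" "unitary_between L M W"
  shows "unitary_between K M (W \<circ> U)"
  using assms bij_betw_trans[of U K L W M] bij_betw_apply[of U K L]
  by (auto simp: unitary_between_def)

lemma unitary_between_cong:
  assumes U: "unitary_between K L U" and K: "csubspace K" and eq: "\<And>x. x \<in> K \<Longrightarrow> U x = U' x"
  shows "unitary_between K L U'"
  using U bij_betw_cong[of K U U' L, OF eq] complex_vector.subspace_add[OF K]
    complex_vector.subspace_scale[OF K]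
  by (simp add: unitary_between_def eq[symmetric])

lemma unitary_between_inv:
  assumes U: "unitary_between K L U" and K: "csubspace K"
  shows "unitary_between L K (inv_into K U)"
proof -
  note D = unitary_betweenD[OF U]
  have r: "U (inv_into K U y) = y" "inv_into K U y \<in> K" if "y \<in> L" for y
    using that D(3) by (metis f_inv_into_f, metis inv_into_into)
  have eq: "inv_into K U y = x" if "x \<in> K" "U x = y" for x y
    using that D(2) by (metis inv_into_f_f)
  show ?thesis
    unfolding unitary_between_def
  proof (intro conjI ballI allI)
    show "bij_betw (inv_into K U) L K"
      using U bij_betw_inv_into unfolding unitary_between_def by blast
    fix x y c assume "x \<in> L" "y \<in> L"
    then show "inv_into K U (x + y) = inv_into K U x + inv_into K U y"
      by (intro eq) (simp_all add: r D complex_vector.subspace_add[OF K])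
    show "cinner (inv_into K U x) (inv_into K U y) = cinner x y"
      using D(6)[OF r(2) r(2)] r(1) \<open>x \<in> L\<close> \<open>y \<in> L\<close> by metis
  next
    fix x c assume "x \<in> L"
    then show "inv_into K U (c *\<^sub>C x) = c *\<^sub>C inv_into K U x"
      by (intro eq) (simp_all add: r D complex_vector.subspace_scale[OF K])
  qed
qed

lemma unitary_between_dist:
  assumes U: "unitary_between K L U" and K: "csubspace K" and xy: "x \<in> K" "y \<in> K"
  shows "dist (U x) (U y) = dist x y"
proof -
  note D = unitary_betweenD[OF U]
  have "(-1) *\<^sub>C y \<in> K"
    using K xy(2) by (rule complex_vector.subspace_scale)
  then have "U (x - y) = U x - U y"
    using D(4)[OF xy(1), of "(-1) *\<^sub>C y"] D(5)[OF xy(2), of "-1"] by simp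
  then have "cinner (U x - U y) (U x - U y) = cinner (x - y) (x - y)"
    using D(6)[of "x - y" "x - y"] complex_vector.subspace_diff[OF K xy] by simp
  then have "(norm (U x - U y))\<^sup>2 = (norm (x - y))\<^sup>2"
    unfolding cinner_self_eq of_real_eq_iff .
  then show ?thesis
    by (simp add: dist_norm)
qed

text \<open>With this lemma, an inclusion \<open>U (orbit) \<subseteq> M\<close> extends to the closed span of the orbit, although
  nothing is known about \<open>U\<close> outside of \<open>K\<close>.\<close>

lemma hilbert_subspace_unitary_preimage:
  assumes U: "unitary_between K L U" and K: "hilbert_subspace K" and M: "hilbert_subspace M"
  shows "hilbert_subspace {x \<in> K. U x \<in> M}"
proof -
  note D = unitary_betweenD[OF U]
  have K': "csubspace K" "closed K" and M': "csubspace M" "closed M"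
    using K M by (auto simp: hilbert_subspace_def)
  have "U 0 = 0"
    using D(5)[OF complex_vector.subspace_0[OF K'(1)], of 0] by simp
  then have "csubspace {x \<in> K. U x \<in> M}"
    using K'(1) M'(1) unfolding complex_vector.subspace_def by (auto simp: D)
  moreover have "continuous_on K U"
    unfolding continuous_on_iff using unitary_between_dist[OF U K'(1)] by metis
  then have "closed (K \<inter> U -` M)"
    by (rule continuous_closed_preimage[OF _ K'(2) M'(2)])
  then have "closed {x \<in> K. U x \<in> M}"
    by (simp add: vimage_def Int_def)
  ultimately show ?thesis
    by (simp add: hilbert_subspace_def)
qed

section \<open>Unitary dilations\<close>

text \<open>The projection onto the range of an isometry \<open>V\<close> is \<open>V V\<^sup>*\<close>. This turns the dilation property into
  the equations \<open>\<langle>U\<^sup>n V h, V k\<rangle> = \<langle>T\<^sup>n h, k\<rangle>\<close>, in which no projection occurs.\<close>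

lemma eq_proj_onto_range_isometry_iff:
  fixes V :: "'a::chilbert_space \<Rightarrow> 'b::chilbert_space"
  assumes V: "clinear V" and iso: "\<And>x y. cinner (V x) (V y) = cinner x y"
  shows "V a = proj_onto (range V) y \<longleftrightarrow> (\<forall>k. cinner y (V k) = cinner a k)"
proof -
  have "norm (V x) = norm x" for x
    using iso[of x x] unfolding cinner_self_eq of_real_eq_iff by simp
  then have "bounded_clinear V"
    using V unfolding bounded_clinear_def by (metis mult_1 order_refl)
  note adj = cinner_cadjoint'[OF this]
  have "proj_onto (range V) y = V (cadjoint V y)"
    unfolding proj_onto_def
  proof (rule the_equality)
    show "V (cadjoint V y) \<in> range V \<and> (\<forall>m\<in>range V. cinner (y - V (cadjoint V y)) m = 0)"
      by (auto simp: cinner_diff_left iso adj)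
    fix z assume z: "z \<in> range V \<and> (\<forall>m\<in>range V. cinner (y - z) m = 0)"
    then obtain b where b: "z = V b" by blast
    have "cinner k b = cinner k (cadjoint V y)" for k
    proof -
      have "cinner b k = cinner (cadjoint V y) k"
        using z by (auto simp: b cinner_diff_left iso adj)
      then show ?thesis
        by (metis cinner_commute)
    qed
    then show "z = V (cadjoint V y)"
      unfolding b by (metis cinner_eqI)
  qed
  moreover have "V a = V b \<longleftrightarrow> (\<forall>k. cinner b k = cinner a k)" for b
  proof
    assume "V a = V b"
    then show "\<forall>k. cinner b k = cinner a k"
      by (metis iso)
  next
    assume "\<forall>k. cinner b k = cinner a k"
    then show "V a = V b"
      by (metis cinner_commute cinner_eqI)
  qed
  ultimately show ?thesis
    by (simp add: adj)
qed

lemma unitary_dilation_iff: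
  "unitary_dilation T V K U \<longleftrightarrow>
    hilbert_subspace K \<and> clinear V \<and> (\<forall>x y. cinner (V x) (V y) = cinner x y) \<and> range V \<subseteq> K \<and>
    unitary_between K K U \<and>
    (\<forall>n h k. cinner ((U ^^ n) (V h)) (V k) = cinner ((T ^^ n) h) k)"
  unfolding unitary_dilation_def by (metis eq_proj_onto_range_isometry_iff)

lemma funpow_closed: "(\<And>x. x \<in> K \<Longrightarrow> f x \<in> K) \<Longrightarrow> x \<in> K \<Longrightarrow> (f ^^ n) x \<in> K"
  by (induction n) auto

lemma int_power_on_mem:
  assumes "bij_betw U K K" "x \<in> K"
  shows "int_power_on K U n x \<in> K"
  unfolding int_power_on_def
  using assms bij_betw_apply[OF assms(1)] bij_betw_apply[OF bij_betw_inv_into[OF assms(1)]]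
  by (simp add: funpow_closed)

lemma int_power_on_succ:
  assumes "bij_betw U K K" "x \<in> K"
  shows "U (int_power_on K U n x) = int_power_on K U (n + 1) x"
proof (cases "0 \<le> n")
  case True
  then show ?thesis
    by (simp add: int_power_on_def nat_add_distrib)
next
  case False
  then obtain m where n: "n = - int (Suc m)"
    by (metis not_le negD of_nat_Suc)
  have "(inv_into K U ^^ m) x \<in> K"
    using assms bij_betw_apply[OF bij_betw_inv_into[OF assms(1)]] by (simp add: funpow_closed)
  then have "U (int_power_on K U n x) = (inv_into K U ^^ m) x"
    unfolding n by (simp add: int_power_on_def bij_betw_inv_into_right[OF assms(1)] del: of_nat_Suc)
  also have "\<dots> = int_power_on K U (n + 1) x"
  proof -
    have "n + 1 = - int m"
      by (simp add: n)
    then show ?thesis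
      by (cases "m = 0") (simp_all add: int_power_on_def)
  qed
  finally show ?thesis .
qed

lemma int_power_on_pred:
  assumes "bij_betw U K K" "x \<in> K"
  shows "inv_into K U (int_power_on K U n x) = int_power_on K U (n - 1) x"
  using int_power_on_succ[OF assms, of "n - 1"]
    bij_betw_inv_into_left[OF assms(1) int_power_on_mem[OF assms, of "n - 1"]] by simp

definition orbit_span :: "('h \<Rightarrow> 'k::chilbert_space) \<Rightarrow> 'k set \<Rightarrow> ('k \<Rightarrow> 'k) \<Rightarrow> 'k set"
  where "orbit_span V K U = closure (cspan (\<Union>n. int_power_on K U n ` range V))"

lemma hilbert_subspace_orbit_span: "hilbert_subspace (orbit_span V K U)"
  unfolding hilbert_subspace_def orbit_span_def
  by (simp add: csubspace_closure complex_vector.subspace_span)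

lemma orbit_span_base: "int_power_on K U n (V h) \<in> orbit_span V K U"
  unfolding orbit_span_def
  by (rule subsetD[OF closure_subset], rule complex_vector.span_base) blast

lemma orbit_span_least:
  assumes "hilbert_subspace N" "\<And>n h. int_power_on K U n (V h) \<in> N"
  shows "orbit_span V K U \<subseteq> N"
  unfolding orbit_span_def
  using assms unfolding hilbert_subspace_def
  by (intro closure_minimal complex_vector.span_minimal) auto

text \<open>Applying \<open>U\<close> or its inverse only shifts the exponent of the orbit, and the vectors that
  \<open>U\<close> maps into the orbit span form a closed subspace.\<close>

lemma orbit_span_invariant:
  assumes U: "unitary_between K K U" and K: "hilbert_subspace K" and V: "range V \<subseteq> K"
    and x: "x \<in> orbit_span V K U"
  shows "U x \<in> orbit_span V K U" "inv_into K U x \<in> orbit_span V K U"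
proof -
  let ?M = "orbit_span V K U"
  have b: "bij_betw U K K"
    using U by (simp add: unitary_between_def)
  have Vh: "V h \<in> K" for h
    using V by blast
  have "?M \<subseteq> {x \<in> K. U x \<in> ?M}"
    by (rule orbit_span_least[OF hilbert_subspace_unitary_preimage[OF U K hilbert_subspace_orbit_span]])
      (simp add: int_power_on_mem[OF b Vh] int_power_on_succ[OF b Vh] orbit_span_base)
  then show "U x \<in> ?M"
    using x by blast
  have U': "unitary_between K K (inv_into K U)"
    using U K unitary_between_inv by (auto simp: hilbert_subspace_def)
  have "?M \<subseteq> {x \<in> K. inv_into K U x \<in> ?M}"
    by (rule orbit_span_least[OF hilbert_subspace_unitary_preimage[OF U' K hilbert_subspace_orbit_span]])
      (simp add: int_power_on_mem[OF b Vh] int_power_on_pred[OF b Vh] orbit_span_base)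
  then show "inv_into K U x \<in> ?M"
    using x by blast
qed

text \<open>Unitarity of \<open>U'\<close> on \<open>K'\<close> follows from \<open>U' = W U W\<^sup>-\<^sup>1\<close>. The orbit of \<open>V'\<close> is the image of the orbit
  of \<open>V\<close>, so the preimage under \<open>W\<close> of its closed span is a closed subspace that contains the
  orbit of \<open>V\<close>, hence all of \<open>K\<close>.\<close>

lemma minimal_unitary_dilation_transport:
  fixes W :: "'k::chilbert_space \<Rightarrow> 'l::chilbert_space"
  assumes dil: "minimal_unitary_dilation T V K U"
    and K': "hilbert_subspace K'" and W: "unitary_between K K' W"
    and WU: "\<And>x. x \<in> K \<Longrightarrow> W (U x) = U' (W x)" and WV: "\<And>h. W (V h) = V' h"
  shows "minimal_unitary_dilation T V' K' U'"
proof -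
  note dil' = dil[unfolded minimal_unitary_dilation_def unitary_dilation_iff]
  have K: "hilbert_subspace K" "csubspace K" and V: "clinear V" "range V \<subseteq> K"
    and isoV: "\<And>x y. cinner (V x) (V y) = cinner x y"
    and U: "unitary_between K K U"
    and comp: "\<And>n h k. cinner ((U ^^ n) (V h)) (V k) = cinner ((T ^^ n) h) k"
    using dil' by (auto simp: hilbert_subspace_def)
  have span: "orbit_span V K U = K"
    using dil' by (simp add: orbit_span_def)
  have Vh: "V h \<in> K" for h
    using V by blast
  note DW = unitary_betweenD[OF W] and DU = unitary_betweenD[OF U]
  have W': "unitary_between K' K (inv_into K W)"
    by (rule unitary_between_inv[OF W K(2)])
  have right: "W (inv_into K W y) = y" if "y \<in> K'" for y
    using that DW(3) by (metis f_inv_into_f)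
  have U'_eq: "(W \<circ> U \<circ> inv_into K W) y = U' y" if "y \<in> K'" for y
    using WU[OF unitary_betweenD(1)[OF W' that]] right[OF that] by simp
  have U': "unitary_between K' K' U'"
    by (rule unitary_between_cong[OF
          unitary_between_comp[OF W' unitary_between_comp[OF U W]] _ U'_eq])
      (use K' in \<open>auto simp: hilbert_subspace_def\<close>)
  have b: "bij_betw U K K" and b': "bij_betw U' K' K'"
    using U U' by (simp_all add: unitary_between_def)
  have V'K: "V' h \<in> K'" for h
    unfolding WV[symmetric] by (rule DW(1)[OF Vh])
  have pow: "(U' ^^ n) (W x) = W ((U ^^ n) x)" if "x \<in> K" for n x
    using that by (induction n) (simp_all add: WU funpow_closed[OF DU(1)])
  have inv: "inv_into K' U' (W x) = W (inv_into K U x)" if "x \<in> K" for x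
  proof (rule inv_into_f_eq)
    have "inv_into K U x \<in> K"
      using b that by (metis bij_betw_apply bij_betw_inv_into)
    then show "W (inv_into K U x) \<in> K'" "U' (W (inv_into K U x)) = W x"
      using that by (simp_all add: DW(1) WU[symmetric] bij_betw_inv_into_right[OF b])
  qed (use b' in \<open>simp add: bij_betw_def\<close>)
  have inv_pow: "(inv_into K' U' ^^ n) (W x) = W ((inv_into K U ^^ n) x)" if "x \<in> K" for n x
    using that bij_betw_apply[OF bij_betw_inv_into[OF b]]
    by (induction n) (simp_all add: inv funpow_closed)
  have ipow: "int_power_on K' U' n (V' h) = W (int_power_on K U n (V h))" for n h
    by (simp add: int_power_on_def pow[OF Vh] inv_pow[OF Vh] flip: WV)
  have "unitary_dilation T V' K' U'"
    unfolding unitary_dilation_iff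
  proof (intro conjI allI)
    show "clinear V'"
      unfolding WV[symmetric]
      by (rule clinearI) (simp_all add: clinear_add[OF V(1)] clinear_scaleC[OF V(1)] DW Vh)
    show "cinner (V' x) (V' y) = cinner x y" for x y
      by (simp add: DW Vh isoV flip: WV)
    show "range V' \<subseteq> K'"
      using V'K by blast
    show "cinner ((U' ^^ n) (V' h)) (V' k) = cinner ((T ^^ n) h) k" for n h k
      by (simp add: pow DW Vh comp funpow_closed[OF DU(1)] flip: WV)
  qed (fact K' U')+
  moreover have "orbit_span V' K' U' = K'"
  proof
    show "orbit_span V' K' U' \<subseteq> K'"
      by (rule orbit_span_least[OF K' int_power_on_mem[OF b' V'K]])
    have "orbit_span V K U \<subseteq> {x \<in> K. W x \<in> orbit_span V' K' U'}"
      by (rule orbit_span_least[OF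
            hilbert_subspace_unitary_preimage[OF W K(1) hilbert_subspace_orbit_span]])
        (simp add: int_power_on_mem[OF b Vh] orbit_span_base flip: ipow)
    then show "K' \<subseteq> orbit_span V' K' U'"
      unfolding span DW(3)[symmetric] by blast
  qed
  ultimately show ?thesis
    by (simp add: minimal_unitary_dilation_def orbit_span_def)
qed

section \<open>Square-summable sequences\<close>

lemma ell2_eqI: "(\<And>n. ell2_nth f n = ell2_nth g n) \<Longrightarrow> f = g"
  by (simp add: ell2_nth_inject[symmetric] fun_eq_iff)

lemma bounded_linear_ell2_nth: "bounded_linear (\<lambda>f. ell2_nth f n)"
  by (rule bounded_linear_intro[where K = 1])
    (simp_all add: plus_ell2.rep_eq scaleR_ell2.rep_eq norm_ell2_nth_le)

lemma ell2_cinner_sums: "(\<lambda>n. cinner (ell2_nth f n) (ell2_nth g n)) sums cinner f g"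
  unfolding cinner_ell2.rep_eq by (intro summable_sums summable_cinner summable_ell2_nth)

lemma sums_pairs:
  fixes a :: "nat \<Rightarrow> 'a::real_normed_vector"
  assumes "a sums s"
  shows "(\<lambda>k. a (2 * k) + a (2 * k + 1)) sums s"
proof -
  have "sum a {k * 2..<k * 2 + 2} = a (2 * k) + a (2 * k + 1)" for k
    by (simp add: numeral_2_eq_2 mult.commute)
  then show ?thesis
    using sums_group[OF assms, of 2] by simp
qed

lemma nat_cases_odd_even:
  fixes n :: nat
  obtains "n = 0" | k where "n = 2 * k + 1" | k where "n = 2 * k + 2"
proof -
  have "n = 0 \<or> (\<exists>k. n = 2 * k + 1) \<or> (\<exists>k. n = 2 * k + 2)"
    by presburger
  then show ?thesis
    using that by blast
qed

lift_definition ell2_single :: "nat \<Rightarrow> 'a::complex_inner \<Rightarrow> 'a ell2"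
  is "\<lambda>n x m. if m = n then x else 0"
proof -
  fix n :: nat and x :: 'a
  have "(\<lambda>m. (norm (if m = n then x else 0))\<^sup>2) = (\<lambda>m. if m = n then (norm x)\<^sup>2 else 0)"
    by auto
  then show "summable (\<lambda>m. (norm (if m = n then x else 0))\<^sup>2)"
    using sums_single[of n "\<lambda>_. (norm x)\<^sup>2"] by (auto simp: summable_def)
qed

lemma ell2_nth_sum: "ell2_nth (\<Sum>i\<in>A. g i) n = (\<Sum>i\<in>A. ell2_nth (g i) n)"
  by (induction A rule: infinite_finite_induct)
    (simp_all add: zero_ell2.rep_eq plus_ell2.rep_eq)

lemma bounded_linear_ell2_single: "bounded_linear (ell2_single n)"
proof (rule bounded_linear_intro[where K = 1])
  fix x y :: 'a and r
  show "ell2_single n (x + y) = ell2_single n x + ell2_single n y"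
    "ell2_single n (r *\<^sub>R x) = r *\<^sub>R ell2_single n x"
    by (transfer; auto)+
  have "(\<lambda>m. (norm (ell2_nth (ell2_single n x) m))\<^sup>2) = (\<lambda>m. if m = n then (norm x)\<^sup>2 else 0)"
    by (auto simp: ell2_single.rep_eq)
  then have "(norm (ell2_single n x))\<^sup>2 = (norm x)\<^sup>2"
    unfolding norm_ell2_power2 using sums_single[of n "\<lambda>_. (norm x)\<^sup>2"] by (simp add: sums_iff)
  then show "norm (ell2_single n x) \<le> norm x * 1"
    by simp
qed

text \<open>The squared error of a partial sum is the tail of the convergent series for \<open>\<parallel>f\<parallel>\<^sup>2\<close>.\<close>

lemma ell2_single_partial_sums:
  "(\<lambda>N. \<Sum>n<N. ell2_single n (ell2_nth f n)) \<longlonglongrightarrow> f"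
proof (rule LIMSEQ_I)
  fix r :: real assume "0 < r"
  define S where "S N = (\<Sum>n<N. ell2_single n (ell2_nth f n))" for N
  have nth: "ell2_nth (S N - f) n = (if n < N then 0 else - ell2_nth f n)" for N n
    by (simp add: S_def minus_ell2.rep_eq ell2_nth_sum ell2_single.rep_eq)
  have tail: "(norm (S N - f))\<^sup>2 = (\<Sum>n. (norm (ell2_nth f (n + N)))\<^sup>2)" for N
    unfolding norm_ell2_power2
    by (subst suminf_split_initial_segment[OF summable_ell2_nth, of _ N]) (simp add: nth)
  obtain N0 where N0: "\<And>N. N \<ge> N0 \<Longrightarrow> norm (\<Sum>n. (norm (ell2_nth f (n + N)))\<^sup>2) < r\<^sup>2"
    using suminf_exist_split[OF _ summable_ell2_nth[of f], of "r\<^sup>2"] \<open>0 < r\<close> by auto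
  have "norm (S N - f) < r" if "N \<ge> N0" for N
    using N0[OF that] \<open>0 < r\<close> unfolding tail[symmetric]
    by (intro power2_less_imp_less[of _ r]) auto
  then show "\<exists>N0. \<forall>N\<ge>N0. norm ((\<Sum>n<N. ell2_single n (ell2_nth f n)) - f) < r"
    unfolding S_def by blast
qed

lemma hilbert_subspace_orth_sum:
  fixes S :: "nat \<Rightarrow> 'a::chilbert_space set"
  assumes "\<And>n. hilbert_subspace (S n)"
  shows "hilbert_subspace (orth_sum S)"
  unfolding hilbert_subspace_def
proof
  show "csubspace (orth_sum S)"
    using assms unfolding hilbert_subspace_def complex_vector.subspace_def orth_sum_def
    by (simp add: zero_ell2.rep_eq plus_ell2.rep_eq scaleC_ell2.rep_eq)
  have "closed ((\<lambda>f. ell2_nth f n) -` S n)" for n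
    using assms bounded_linear.continuous_on[OF bounded_linear_ell2_nth continuous_on_id]
    by (intro closed_vimage) (simp_all add: hilbert_subspace_def)
  then have "closed (\<Inter>n. (\<lambda>f. ell2_nth f n) -` S n)"
    by blast
  then show "closed (orth_sum S)"
    by (simp add: orth_sum_def vimage_def INTER_eq)
qed

lemma orth_sum_subset:
  fixes S :: "nat \<Rightarrow> 'a::chilbert_space set"
  assumes M: "hilbert_subspace M" and S: "\<And>n x. x \<in> S n \<Longrightarrow> ell2_single n x \<in> M"
  shows "orth_sum S \<subseteq> M"
proof
  fix f assume "f \<in> orth_sum S"
  then have "(\<Sum>n<N. ell2_single n (ell2_nth f n)) \<in> M" for N
    using M S by (intro complex_vector.subspace_sum) (auto simp: hilbert_subspace_def orth_sum_def)
  then show "f \<in> M"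
    using M closed_sequentially[OF _ _ ell2_single_partial_sums] by (auto simp: hilbert_subspace_def)
qed

section \<open>The operators \<open>M0\<close> and \<open>L0\<close>\<close>

lemma embed_H_eq: "embed_H = ell2_single 0"
proof
  show "embed_H h = ell2_single 0 h" for h
    by (rule ell2_eqI) (simp add: embed_H.rep_eq ell2_single.rep_eq split: nat.split)
qed

lemma cinner_embed_H: "cinner f (embed_H k) = cinner (ell2_nth f 0) k"
proof -
  have "(\<lambda>n. cinner (ell2_nth f n) (ell2_nth (embed_H k) n))
    = (\<lambda>n. if n = 0 then cinner (ell2_nth f n) k else 0)"
    by (auto simp: embed_H_eq ell2_single.rep_eq)
  then show ?thesis
    using ell2_cinner_sums[of f "embed_H k"] sums_single[of 0 "\<lambda>n. cinner (ell2_nth f n) k"]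
    by (simp add: sums_unique2)
qed

lemma clinear_embed_H: "clinear embed_H"
  unfolding embed_H_eq by (rule clinearI; transfer; auto)

lemma nth_M0:
  "ell2_nth (M0 f) 0 = ell2_nth f 0"
  "ell2_nth (M0 f) (2 * k + 1) = ell2_nth f (2 * k + 2)"
  "ell2_nth (M0 f) (2 * k + 2) = ell2_nth f (2 * k + 1)"
  by (simp_all add: M0.rep_eq pair_sum_def J0_def Let_def)

lemma nth_L0:
  "ell2_nth (L0 T f) 0 = T (ell2_nth f 0) + defect_op_adj T (ell2_nth f 1)"
  "ell2_nth (L0 T f) 1 = defect_op T (ell2_nth f 0) - cadjoint T (ell2_nth f 1)"
  "ell2_nth (L0 T f) (2 * k + 2) = ell2_nth f (2 * k + 3)"
  "ell2_nth (L0 T f) (2 * k + 3) = ell2_nth f (2 * k + 2)"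
  by (simp_all add: L0.rep_eq pair_sum_def J0_def JT_def Let_def numeral_3_eq_3)

text \<open>\<open>M0\<close> groups the entries as \<open>0 | 1 2 | 3 4 | \<dots>\<close> and \<open>L0\<close> as \<open>0 1 | 2 3 | 4 5 | \<dots>\<close>; each of
  the next two extensionality rules follows one of these groupings.\<close>

lemma ell2_eqI_M0:
  assumes "ell2_nth f 0 = ell2_nth g 0" "\<And>k. ell2_nth f (2 * k + 1) = ell2_nth g (2 * k + 1)"
    "\<And>k. ell2_nth f (2 * k + 2) = ell2_nth g (2 * k + 2)"
  shows "f = g"
proof (rule ell2_eqI)
  show "ell2_nth f n = ell2_nth g n" for n
    by (rule nat_cases_odd_even[of n]) (use assms in simp_all)
qed

lemma ell2_eqI_L0:
  assumes "ell2_nth f 0 = ell2_nth g 0" "ell2_nth f 1 = ell2_nth g 1"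
    "\<And>k. ell2_nth f (2 * k + 2) = ell2_nth g (2 * k + 2)"
    "\<And>k. ell2_nth f (2 * k + 3) = ell2_nth g (2 * k + 3)"
  shows "f = g"
proof (rule ell2_eqI_M0)
  show "ell2_nth f (2 * k + 1) = ell2_nth g (2 * k + 1)" for k
    using assms(2) assms(4)[of "k - 1"] by (cases k) (simp_all add: numeral_3_eq_3)
qed (use assms in auto)

lemma clinear_M0: "clinear M0"
  by (rule clinearI; rule ell2_eqI_M0) (simp_all only: nth_M0 plus_ell2.rep_eq scaleC_ell2.rep_eq)

lemma M0_M0: "M0 (M0 f) = f"
  by (rule ell2_eqI_M0) (simp_all only: nth_M0)

lemma cinner_M0: "cinner (M0 f) (M0 g) = cinner f g"
proof -
  define c where "c u v n = cinner (ell2_nth u n) (ell2_nth v n)" for u v :: "'a ell2" and n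
  have split: "(\<lambda>k. c u v (2 * k + 1) + c u v (2 * k + 2)) sums (cinner u v - c u v 0)" for u v
  proof -
    have "(\<lambda>n. c u v (Suc n)) sums (cinner u v - c u v 0)"
      using ell2_cinner_sums[of u v] by (subst sums_Suc_iff) (simp add: c_def[abs_def])
    from sums_pairs[OF this] show ?thesis by simp
  qed
  have "(\<lambda>k. c (M0 f) (M0 g) (2 * k + 1) + c (M0 f) (M0 g) (2 * k + 2))
      = (\<lambda>k. c f g (2 * k + 1) + c f g (2 * k + 2))"
    unfolding c_def nth_M0 by (rule ext) (rule add.commute)
  then have "cinner (M0 f) (M0 g) - c (M0 f) (M0 g) 0 = cinner f g - c f g 0"
    using split[of "M0 f" "M0 g"] split[of f g] sums_unique2 by simp
  then show ?thesis
    by (simp add: c_def nth_M0)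
qed

lemma M0_embed_H: "M0 (embed_H h) = embed_H h"
  by (rule ell2_eqI_M0) (simp_all only: nth_M0, simp_all add: embed_H_eq ell2_single.rep_eq)

lemma hilbert_subspace_defect_space:
  fixes T :: "'h::chilbert_space \<Rightarrow> 'h"
  assumes "contraction T"
  shows "hilbert_subspace (defect_space T)"
proof -
  note lin = clinear_defect_op[OF assms]
  have "csubspace (range (defect_op T))"
    unfolding complex_vector.subspace_def
    by (auto simp: image_iff simp flip: clinear_add[OF lin] clinear_scaleC[OF lin])
      (metis clinear_zero[OF lin])
  then show ?thesis
    unfolding hilbert_subspace_def defect_space_def by (simp add: csubspace_closure)
qed

lemma mem_H0_iff:
  "f \<in> H0 T \<longleftrightarrow> (\<forall>k. ell2_nth f (2 * k + 1) \<in> defect_space T) \<and>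
    (\<forall>k. ell2_nth f (2 * k + 2) \<in> defect_space_adj T)"
  (is "_ \<longleftrightarrow> ?R")
proof
  assume "f \<in> H0 T"
  then have *: "ell2_nth f n \<in> case_nat UNIV (alternating (defect_space T) (defect_space_adj T)) n" for n
    by (simp add: H0_def orth_sum_def)
  show ?R
    using *[of "2 * _ + 1"] *[of "2 * _ + 2"] by (simp add: alternating_def)
next
  assume R: ?R
  have "ell2_nth f n \<in> case_nat UNIV (alternating (defect_space T) (defect_space_adj T)) n" for n
    by (rule nat_cases_odd_even[of n]) (use R in \<open>auto simp: alternating_def\<close>)
  then show "f \<in> H0 T"
    by (simp add: H0_def orth_sum_def)
qed

context
  fixes T :: "'h::chilbert_space \<Rightarrow> 'h"
  assumes T: "contraction T"
begin

lemma defect_space_cadjoint: "defect_space (cadjoint T) = defect_space_adj T"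
  by (simp add: defect_space_def defect_space_adj_def defect_op_cadjoint[OF T])

lemma defect_space_adj_cadjoint: "defect_space_adj (cadjoint T) = defect_space T"
  by (simp add: defect_space_def defect_space_adj_def defect_op_adj_cadjoint[OF T])

lemma H0_cadjoint: "H0 (cadjoint T) = H0_tilde T"
  by (simp add: H0_def H0_tilde_def defect_space_cadjoint defect_space_adj_cadjoint)

lemma hilbert_subspace_H0: "hilbert_subspace (H0 T)"
  unfolding H0_def
proof (rule hilbert_subspace_orth_sum)
  have "hilbert_subspace (defect_space T)" "hilbert_subspace (defect_space_adj T)"
    using hilbert_subspace_defect_space[OF T]
      hilbert_subspace_defect_space[OF contraction_cadjoint[OF T]]
    by (simp_all add: defect_space_cadjoint)
  then show "hilbert_subspace (case_nat UNIV (alternating (defect_space T) (defect_space_adj T)) n)" for n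
    by (cases n) (auto simp: alternating_def hilbert_subspace_def)
qed

text \<open>\<open>T\<^sup>* D\<^sub>* = D T\<^sup>*\<close> settles the range of \<open>D\<^sub>*\<close>, and \<open>T\<^sup>*\<close> is continuous.\<close>

lemma cadjoint_defect_space_adj:
  assumes "x \<in> defect_space_adj T"
  shows "cadjoint T x \<in> defect_space T"
proof -
  note Ts = contraction_cadjoint[OF T]
  have "cadjoint T ` closure (range (defect_op_adj T)) \<subseteq> closure (range (defect_op T))"
  proof (rule image_closure_subset)
    show "continuous_on (closure (range (defect_op_adj T))) (cadjoint T)"
      by (rule bounded_linear.continuous_on[OF bounded_clinear_imp_bounded_linear
            [OF contraction_imp_bounded_clinear[OF Ts]] continuous_on_id])
    show "cadjoint T ` range (defect_op_adj T) \<subseteq> closure (range (defect_op T))"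
      using closure_subset[of "range (defect_op T)"] by (auto simp: defect_op_adj_intertwine[OF T])
  qed simp
  then show ?thesis
    using assms by (auto simp: defect_space_def defect_space_adj_def)
qed

lemma L0_mem_H0:
  assumes "f \<in> H0_tilde T"
  shows "L0 T f \<in> H0 T"
proof -
  have f: "ell2_nth f (2 * k + 1) \<in> defect_space_adj T" "ell2_nth f (2 * k + 2) \<in> defect_space T" for k
    using assms unfolding H0_cadjoint[symmetric] mem_H0_iff
    by (simp_all add: defect_space_cadjoint defect_space_adj_cadjoint)
  have D: "csubspace (defect_space T)"
    using hilbert_subspace_defect_space[OF T] by (simp add: hilbert_subspace_def)
  show ?thesis
    unfolding mem_H0_iff
  proof (intro conjI allI)
    fix k
    have "defect_op T x \<in> defect_space T" for x
      unfolding defect_space_def by (rule subsetD[OF closure_subset rangeI])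
    then have "ell2_nth (L0 T f) 1 \<in> defect_space T"
      unfolding nth_L0
      using complex_vector.subspace_diff[OF D _ cadjoint_defect_space_adj[OF f(1)[of 0]]] by simp
    then show "ell2_nth (L0 T f) (2 * k + 1) \<in> defect_space T"
      using nth_L0(4)[of T f "k - 1"] f(2)[of "k - 1"] by (cases k) (simp_all add: numeral_3_eq_3)
    show "ell2_nth (L0 T f) (2 * k + 2) \<in> defect_space_adj T"
      using f(1)[of "Suc k"] unfolding nth_L0 by (simp add: numeral_3_eq_3)
  qed
qed

lemma clinear_L0: "clinear (L0 T)"
proof -
  note lin = clinear_JT_entries[OF T]
  show ?thesis
    by (rule clinearI; rule ell2_eqI_L0)
      (simp_all only: nth_L0 plus_ell2.rep_eq scaleC_ell2.rep_eq lin[THEN clinear_add]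
        lin[THEN clinear_scaleC],
       simp_all add: scaleC_add_right complex_vector.scale_right_diff_distrib)
qed

text \<open>In the first two entries this is the block identity
  \<open>T\<^sup>* (T x + D\<^sub>* y) + D (D x - T\<^sup>* y) = x\<close>, \<open>D\<^sub>* (T x + D\<^sub>* y) - T (D x - T\<^sup>* y) = y\<close>; the mixed
  terms cancel by the intertwining relations.\<close>

lemma L0_cadjoint_L0: "L0 (cadjoint T) (L0 T f) = f"
proof -
  note adj = defect_op_cadjoint[OF T] defect_op_adj_cadjoint[OF T]
    cadjoint_cadjoint[OF contraction_imp_bounded_clinear[OF T]]
  note lin = clinear_JT_entries[OF T]
  show ?thesis
    by (rule ell2_eqI_L0)
      (simp_all only: nth_L0 adj lin[THEN clinear_add] lin[THEN clinear_diff]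
        defect_op_defect_op[OF T] defect_op_adj_defect_op_adj[OF T]
        defect_op_intertwine[OF T] defect_op_adj_intertwine[OF T], simp_all)
qed

text \<open>The block \<open>JT T\<close> preserves inner products: its columns are isometric, and they are orthogonal to
  each other because \<open>\<langle>T u, D\<^sub>* v\<rangle> = \<langle>D u, T\<^sup>* v\<rangle>\<close>.\<close>

lemma cinner_JT:
  "cinner (T x + defect_op_adj T y) (T x' + defect_op_adj T y') +
    cinner (defect_op T x - cadjoint T y) (defect_op T x' - cadjoint T y') = cinner x x' + cinner y y'"
proof -
  note b = contraction_imp_bounded_clinear[OF T]
  note sa = defect_op_selfadjoint[OF T] defect_op_adj_selfadjoint[OF T]
  note sq = defect_op_defect_op[OF T] defect_op_adj_defect_op_adj[OF T]
  have diag: "cinner (T x) (T x') + cinner (defect_op T x) (defect_op T x') = cinner x x'"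
    by (simp add: sa sq cinner_diff_right cinner_cadjoint[OF b])
  have diag': "cinner (defect_op_adj T y) (defect_op_adj T y') + cinner (cadjoint T y) (cadjoint T y')
      = cinner y y'"
    by (simp add: sa sq cinner_diff_right cinner_cadjoint'[OF b])
  have cross: "cinner (T u) (defect_op_adj T v) = cinner (defect_op T u) (cadjoint T v)" for u v
    by (simp add: cinner_cadjoint[OF b, symmetric] defect_op_intertwine[OF T] sa)
  have cross': "cinner (defect_op_adj T v) (T u) = cinner (cadjoint T v) (defect_op T u)" for u v
    by (simp add: cinner_cadjoint'[OF b] defect_op_intertwine[OF T] sa)
  show ?thesis
    unfolding diag[symmetric] diag'[symmetric]
    by (simp add: cinner_simps cross cross')
qed

lemma cinner_L0: "cinner (L0 T f) (L0 T g) = cinner f g"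
proof -
  define c where "c u v n = cinner (ell2_nth u n) (ell2_nth v n)" for u v :: "'h ell2" and n
  have pairs: "(\<lambda>k. c u v (2 * k) + c u v (2 * k + 1)) sums cinner u v" for u v
    using sums_pairs[OF ell2_cinner_sums[of u v]] by (simp add: c_def)
  have "c (L0 T f) (L0 T g) (2 * k) + c (L0 T f) (L0 T g) (2 * k + 1) = c f g (2 * k) + c f g (2 * k + 1)"
    for k
  proof (cases k)
    case 0
    then show ?thesis
      using cinner_JT by (simp add: c_def nth_L0 flip: One_nat_def)
  next
    case (Suc j)
    then have shift: "c u v (2 * k) + c u v (2 * k + 1) = c u v (2 * j + 2) + c u v (2 * j + 3)" for u v
      by (simp add: numeral_3_eq_3)
    show ?thesis
      unfolding shift unfolding c_def nth_L0 by (rule add.commute)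
  qed
  then show ?thesis
    using pairs[of "L0 T f" "L0 T g"] pairs[of f g] sums_unique2 by simp
qed

end

lemma M0_single:
  "M0 (ell2_single 0 x) = ell2_single 0 x"
  "M0 (ell2_single (2 * k + 1) x) = ell2_single (2 * k + 2) x"
  "M0 (ell2_single (2 * k + 2) x) = ell2_single (2 * k + 1) x"
proof -
  show "M0 (ell2_single 0 x) = ell2_single 0 x"
    using M0_embed_H[of x] by (simp only: embed_H_eq)
  have parity: "2 * j + 1 \<noteq> 2 * k + 2" "2 * j + 2 \<noteq> 2 * k + 1" for j
    by presburger+
  show *: "M0 (ell2_single (2 * k + 1) x) = ell2_single (2 * k + 2) x"
    by (rule ell2_eqI_M0) (simp_all only: nth_M0 ell2_single.rep_eq parity, simp_all)
  show "M0 (ell2_single (2 * k + 2) x) = ell2_single (2 * k + 1) x"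
    unfolding *[symmetric] by (rule M0_M0)
qed

lemma L0_single_0:
  fixes T :: "'h::chilbert_space \<Rightarrow> 'h"
  assumes T: "contraction T"
  shows "L0 T (ell2_single 0 x) = ell2_single 0 (T x) + ell2_single 1 (defect_op T x)"
proof -
  note lin = clinear_JT_entries[OF T]
  show ?thesis
    by (rule ell2_eqI_L0)
      (simp_all only: nth_L0, simp_all add: plus_ell2.rep_eq ell2_single.rep_eq lin[THEN clinear_zero])
qed

lemma L0_single:
  fixes T :: "'h::chilbert_space \<Rightarrow> 'h"
  assumes T: "contraction T"
  shows "L0 T (ell2_single (2 * k + 2) x) = ell2_single (2 * k + 3) x"
    "L0 T (ell2_single (2 * k + 3) x) = ell2_single (2 * k + 2) x"
proof -
  note lin = clinear_JT_entries[OF T]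
  have parity: "2 * j + 2 \<noteq> 2 * k + 3" "2 * j + 3 \<noteq> 2 * k + 2" for j
    by presburger+
  show "L0 T (ell2_single (2 * k + 2) x) = ell2_single (2 * k + 3) x"
    by (rule ell2_eqI_L0)
      (simp_all only: nth_L0 ell2_single.rep_eq parity, simp_all add: lin[THEN clinear_zero])
  show "L0 T (ell2_single (2 * k + 3) x) = ell2_single (2 * k + 2) x"
    by (rule ell2_eqI_L0)
      (simp_all only: nth_L0 ell2_single.rep_eq parity, simp_all add: lin[THEN clinear_zero])
qed

section \<open>The minimal unitary dilation\<close>

context
  fixes T :: "'h::chilbert_space \<Rightarrow> 'h"
  assumes T: "contraction T"
begin

lemma M0_mem_H0_tilde: "f \<in> H0 T \<Longrightarrow> M0 f \<in> H0_tilde T"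
  and M0_mem_H0: "f \<in> H0_tilde T \<Longrightarrow> M0 f \<in> H0 T"
  unfolding H0_cadjoint[OF T, symmetric] mem_H0_iff nth_M0
  by (simp_all add: defect_space_cadjoint[OF T] defect_space_adj_cadjoint[OF T])

lemma unitary_between_M0: "unitary_between (H0 T) (H0_tilde T) M0"
  by (rule unitary_betweenI[where V = M0, OF clinear_M0 cinner_M0 M0_mem_H0_tilde M0_mem_H0 M0_M0])

lemma L0_cadjoint_mem_H0_tilde: "f \<in> H0 T \<Longrightarrow> L0 (cadjoint T) f \<in> H0_tilde T"
  using L0_mem_H0[OF contraction_cadjoint[OF T], of f] H0_cadjoint[OF contraction_cadjoint[OF T]]
  by (simp add: H0_cadjoint[OF T] cadjoint_cadjoint[OF contraction_imp_bounded_clinear[OF T]])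

lemma L0_L0_cadjoint: "L0 T (L0 (cadjoint T) f) = f"
  using L0_cadjoint_L0[OF contraction_cadjoint[OF T], of f]
  by (simp add: cadjoint_cadjoint[OF contraction_imp_bounded_clinear[OF T]])

lemma unitary_between_L0: "unitary_between (H0_tilde T) (H0 T) (L0 T)"
  by (rule unitary_betweenI[where V = "L0 (cadjoint T)",
        OF clinear_L0[OF T] cinner_L0[OF T] L0_mem_H0[OF T] L0_cadjoint_mem_H0_tilde L0_L0_cadjoint])

lemma unitary_between_U0: "unitary_between (H0 T) (H0 T) (U0 T)"
  unfolding U0_def by (rule unitary_between_comp[OF unitary_between_M0 unitary_between_L0])

lemma inv_U0:
  assumes "f \<in> H0 T"
  shows "inv_into (H0 T) (U0 T) f = M0 (L0 (cadjoint T) f)"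
proof (rule inv_into_f_eq)
  show "inj_on (U0 T) (H0 T)"
    by (rule unitary_betweenD(2)[OF unitary_between_U0])
  show "M0 (L0 (cadjoint T) f) \<in> H0 T"
    by (intro M0_mem_H0 L0_cadjoint_mem_H0_tilde assms)
  show "U0 T (M0 (L0 (cadjoint T) f)) = f"
    by (simp add: U0_def M0_M0 L0_L0_cadjoint)
qed

lemma nth_U0:
  "ell2_nth (U0 T f) 0 = T (ell2_nth f 0) + defect_op_adj T (ell2_nth f 2)"
  "ell2_nth (U0 T f) (2 * k + 2) = ell2_nth f (2 * k + 4)"
  using nth_M0(2)[of f 0] nth_M0(2)[of f "Suc k"]
  unfolding U0_def comp_def nth_L0 by (simp_all add: nth_M0(1) eval_nat_numeral)

lemma embed_H_mem_H0: "embed_H h \<in> H0 T"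
  unfolding mem_H0_iff embed_H_eq ell2_single.rep_eq
  using hilbert_subspace_defect_space[OF T]
    hilbert_subspace_defect_space[OF contraction_cadjoint[OF T]]
  by (simp add: defect_space_cadjoint[OF T] hilbert_subspace_def complex_vector.subspace_0)

lemma nth_embed_H_0: "ell2_nth (embed_H h) 0 = h"
  by (simp add: embed_H_eq ell2_single.rep_eq)

text \<open>The only entry besides \<open>0\<close> that \<open>U0 T\<close> feeds into the entry \<open>0\<close> is the entry \<open>2\<close>, and the even
  entries from \<open>2\<close> on only receive later even entries, so they stay zero.\<close>

lemma U0_pow_embed_H:
  "ell2_nth ((U0 T ^^ n) (embed_H h)) 0 = (T ^^ n) h \<and>
    (\<forall>k. ell2_nth ((U0 T ^^ n) (embed_H h)) (2 * k + 2) = 0)"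
proof (induction n)
  case 0
  show ?case
    by (simp add: embed_H_eq ell2_single.rep_eq)
next
  case (Suc n)
  define f where "f = (U0 T ^^ n) (embed_H h)"
  have f: "ell2_nth f 0 = (T ^^ n) h" "\<And>k. ell2_nth f (2 * k + 2) = 0"
    using Suc by (auto simp: f_def)
  have "ell2_nth (U0 T f) 0 = (T ^^ Suc n) h"
    using f(2)[of 0] by (simp add: nth_U0 f(1) clinear_zero[OF clinear_JT_entries(4)[OF T]] numeral_2_eq_2)
  moreover have "ell2_nth (U0 T f) (2 * k + 2) = 0" for k
    using f(2)[of "Suc k"] unfolding nth_U0 by (simp add: eval_nat_numeral)
  ultimately show ?case
    by (simp add: f_def)
qed

lemma unitary_dilation_U0: "unitary_dilation T embed_H (H0 T) (U0 T)"
  unfolding unitary_dilation_iff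
proof (intro conjI allI)
  show "cinner (embed_H x) (embed_H y) = cinner x y" for x y
    by (simp add: cinner_embed_H nth_embed_H_0)
  show "cinner ((U0 T ^^ n) (embed_H h)) (embed_H k) = cinner ((T ^^ n) h) k" for n h k
    by (simp add: cinner_embed_H U0_pow_embed_H)
qed (use hilbert_subspace_H0[OF T] clinear_embed_H embed_H_mem_H0 unitary_between_U0 in auto)

lemma closure_range_subset_summand:
  fixes D :: "'h \<Rightarrow> 'h" and M :: "'h ell2 set"
  assumes "hilbert_subspace M" "\<And>z. ell2_single n (D z) \<in> M" "x \<in> closure (range D)"
  shows "ell2_single n x \<in> M"
proof -
  have "ell2_single n ` closure (range D) \<subseteq> M"
    using assms(1,2) bounded_linear.continuous_on[OF bounded_linear_ell2_single continuous_on_id]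
    by (intro image_closure_subset) (auto simp: hilbert_subspace_def)
  then show ?thesis
    using assms(3) by blast
qed

text \<open>The orbit span is invariant under \<open>U0 T = L0 T \<circ> M0\<close> and under its inverse \<open>M0 \<circ> L0 T\<^sup>*\<close>. Forward steps
  from \<open>H\<close> reach the odd summands and backward steps the even ones.\<close>

lemma minimal_unitary_dilation_U0: "minimal_unitary_dilation T embed_H (H0 T) (U0 T)"
proof -
  note Ts = contraction_cadjoint[OF T]
  note U = unitary_between_U0 and K = hilbert_subspace_H0[OF T]
  let ?M = "orbit_span embed_H (H0 T) (U0 T)"
  have V: "range embed_H \<subseteq> H0 T"
    using embed_H_mem_H0 by blast
  have b: "bij_betw (U0 T) (H0 T) (H0 T)"
    using U by (simp add: unitary_between_def)
  have M: "hilbert_subspace ?M"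
    by (rule hilbert_subspace_orbit_span)
  have M_sub: "?M \<subseteq> H0 T"
    by (rule orbit_span_least[OF K int_power_on_mem[OF b embed_H_mem_H0]])
  note inv = orbit_span_invariant[OF U K V]
  have fwd: "L0 T (M0 f) \<in> ?M" if "f \<in> ?M" for f
    using inv(1)[OF that] by (simp add: U0_def)
  have bwd: "M0 (L0 (cadjoint T) f) \<in> ?M" if "f \<in> ?M" for f
    using inv(2)[OF that] inv_U0 M_sub that by auto
  have diff: "g \<in> ?M" if "f + g \<in> ?M" "f \<in> ?M" for f g
    using complex_vector.subspace_diff[of ?M "f + g" f] M that by (simp add: hilbert_subspace_def)
  have zero: "ell2_single 0 x \<in> ?M" for x
    using orbit_span_base[of "H0 T" "U0 T" 0 embed_H x] by (simp add: int_power_on_def embed_H_eq)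
  have odd: "ell2_single (2 * k + 1) x \<in> ?M" if x: "x \<in> defect_space T" for k x
  proof (induction k)
    case 0
    have "ell2_single 1 (defect_op T z) \<in> ?M" for z
      using diff[OF _ zero] fwd[OF zero[of z]] by (simp add: M0_single L0_single_0[OF T])
    then show ?case
      using closure_range_subset_summand[OF M _ x[unfolded defect_space_def], of 1] by simp
  next
    case (Suc k)
    from fwd[OF this] show ?case
      unfolding M0_single L0_single[OF T] by (simp add: numeral_3_eq_3)
  qed
  have even: "ell2_single (2 * k + 2) x \<in> ?M" if x: "x \<in> defect_space_adj T" for k x
  proof (induction k)
    case 0
    have "ell2_single 0 (cadjoint T z) + ell2_single 2 (defect_op_adj T z) \<in> ?M" for z
      using bwd[OF zero[of z]] M0_single(2)[of 0 "defect_op_adj T z"]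
      by (simp add: L0_single_0[OF Ts] defect_op_cadjoint[OF T] M0_single(1)
          clinear_add[OF clinear_M0] numeral_2_eq_2)
    then have "ell2_single 2 (defect_op_adj T z) \<in> ?M" for z
      using diff[OF _ zero] by blast
    then show ?case
      using closure_range_subset_summand[OF M _ x[unfolded defect_space_adj_def], of 2] by (simp add: numeral_2_eq_2)
  next
    case (Suc k)
    from bwd[OF this] show ?case
      using M0_single(2)[of "Suc k" x] unfolding L0_single[OF Ts] by (simp add: numeral_3_eq_3)
  qed
  have "H0 T \<subseteq> ?M"
  proof (rule orth_sum_subset[OF M,
        where S = "case_nat UNIV (alternating (defect_space T) (defect_space_adj T))", folded H0_def])
    fix n x
    assume "x \<in> case_nat UNIV (alternating (defect_space T) (defect_space_adj T)) n"
    then show "ell2_single n x \<in> ?M"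
      by (cases n rule: nat_cases_odd_even) (use zero odd even in \<open>auto simp: alternating_def\<close>)
  qed
  then show ?thesis
    using M_sub unitary_dilation_U0 by (auto simp: minimal_unitary_dilation_def orbit_span_def)
qed

lemma M0_U0: "M0 (U0 T f) = U0_tilde T (M0 f)"
  by (simp add: U0_def U0_tilde_def)

end

theorem theorem7p6:
  fixes T :: "'h::chilbert_space \<Rightarrow> 'h"
  assumes "contraction T"
  shows "minimal_unitary_dilation T embed_H (H0 T) (U0 T) \<and>
    minimal_unitary_dilation T embed_H (H0_tilde T) (U0_tilde T) \<and>
    unitarily_equivalent_dilations embed_H (H0 T) (U0 T) embed_H (H0_tilde T) (U0_tilde T)"
proof (intro conjI)
  show dil: "minimal_unitary_dilation T embed_H (H0 T) (U0 T)"
    by (rule minimal_unitary_dilation_U0[OF assms])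
  have "hilbert_subspace (H0_tilde T)"
    using hilbert_subspace_H0[OF contraction_cadjoint[OF assms]] by (simp add: H0_cadjoint[OF assms])
  then show "minimal_unitary_dilation T embed_H (H0_tilde T) (U0_tilde T)"
    by (rule minimal_unitary_dilation_transport[OF dil _ unitary_between_M0[OF assms] M0_U0[OF assms]
          M0_embed_H])
  show "unitarily_equivalent_dilations embed_H (H0 T) (U0 T) embed_H (H0_tilde T) (U0_tilde T)"
    unfolding unitarily_equivalent_dilations_def
    using unitary_between_M0[OF assms] M0_U0[OF assms] M0_embed_H by blast
qed

end
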